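(* Under the standing assumptions in the context, there are constants $c_7,c_8,c_9>0$ such that whenever $\mathcal F\in\mathcal W'$, $(\mathbf u,p)\in\mathcal W$ and $\mathcal A(\mathbf u,p)=\mathcal F$, with $\beta=\|\pi_1\mathcal F\|_{V'}$ and $\gamma=\|\pi_2\mathcal F\|_{Z'}$, one has $$\|\mathbf u\|_{L^s}\le c_7(\beta^{r-1}+\gamma^{r-1}+\gamma),\quad \|\operatorname{div}\mathbf u\|_{L^s}\le c_7\gamma,\quad \|p\|_{Z}\le c_7(\gamma^{r-1}+\gamma^{s-1}+\beta^{r-1}+\beta),$$ $$\|(\mathbf u,p)\|_{\mathcal W}\le c_8(\gamma^{r-1}+\gamma^{s-1}+\beta^{r-1}+\beta),\qquad \|(\mathbf u,p)\|_{\mathcal W}\le c_9(\|\mathcal F\|_{\mathcal W'}^{r-1}+\|\mathcal F\|_{\mathcal W'}^{s-1}).$$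
   Context: $n\ge2$, $\Omega\subset\mathbb R^n$ open bounded with $C^1$ boundary. $F:\mathbb R^n\to\mathbb R^n$ satisfies $F(0)=0$ and, for constants $s>2$, $c_1,c_2>0$ and all $x,y$: $|F(x)-F(y)|\le c_1(1+|x|^{s-2}+|y|^{s-2})|x-y|$ and $(F(x)-F(y))\cdot(x-y)\ge c_2|x-y|^s$. Let $r=s/(s-1)$. $V=\mathbf W_s(\mathrm{div},\Omega)=\{\mathbf v\in(L^s(\Omega))^n:\operatorname{div}\mathbf v\in L^s(\Omega)\}$ with norm $(\|\mathbf v\|_{L^s}^s+\|\operatorname{div}\mathbf v\|_{L^s}^s)^{1/s}$, $Z=L^r(\Omega)$, and $\mathcal W=V\times Z$ with norm $\|(\mathbf u,p)\|_{\mathcal W}=\|\mathbf u\|_V+\|p\|_Z$. Set $a(\mathbf u,\mathbf v)=\int_\Omega F(\mathbf u)\cdot\mathbf v\,dx$, $b(\mathbf v,q)=\int_\Omega(\operatorname{div}\mathbf v)q\,dx$, and $\mathcal A:\mathcal W\to\mathcal W'$ by $\langle\mathcal A(\mathbf u,p),(\mathbf v,q)\rangle=a(\mathbf u,\mathbf v)-b(\mathbf v,p)+b(\mathbf u,q)$. For $\mathcal F\in\mathcal W'$, $\pi_1\mathcal F\in V'$ and $\pi_2\mathcal F\in Z'$ are $(\pi_1\mathcal F)(\mathbf v)=\mathcal F(\mathbf v,0)$ and $(\pi_2\mathcal F)(q)=\mathcal F(0,q)$. *)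

theory Defs
  imports "HOL-Analysis.Analysis"
begin

fun Ck :: "nat \<Rightarrow> ('a::euclidean_space \<Rightarrow> real) \<Rightarrow> 'a set \<Rightarrow> bool" where
  "Ck 0 f S = continuous_on S f"
| "Ck (Suc k) f S = (f differentiable_on S \<and>
      (\<forall>i\<in>Basis. Ck k (\<lambda>x. frechet_derivative f (at x) i) S))"

definition smooth_fun :: "('a::euclidean_space \<Rightarrow> real) \<Rightarrow> bool" where
  "smooth_fun f \<longleftrightarrow> (\<forall>k. Ck k f UNIV)"

definition test_fun :: "'a::euclidean_space set \<Rightarrow> ('a \<Rightarrow> real) \<Rightarrow> bool" where
  "test_fun \<Omega> \<phi> \<longleftrightarrow> smooth_fun \<phi> \<and> compact (closure {x. \<phi> x \<noteq> 0})
      \<and> closure {x. \<phi> x \<noteq> 0} \<subseteq> \<Omega>"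

(* open set with C^1 boundary: locally, after choosing a unit direction e,
   \<Omega> is the supergraph of a C^1 function of the coordinates orthogonal to e *)
definition C1_boundary :: "'a::euclidean_space set \<Rightarrow> bool" where
  "C1_boundary \<Omega> \<longleftrightarrow> (\<forall>x0\<in>frontier \<Omega>. \<exists>\<rho>>0. \<exists>e h. norm e = 1 \<and> Ck 1 h UNIV \<and>
      (\<forall>x\<in>ball x0 \<rho>. x \<in> \<Omega> \<longleftrightarrow> x \<bullet> e > h (x - (x \<bullet> e) *\<^sub>R e)))"

definition Lp :: "'a::euclidean_space set \<Rightarrow> real \<Rightarrow> ('a \<Rightarrow> 'b::real_normed_vector) \<Rightarrow> bool" where
  "Lp \<Omega> p f \<longleftrightarrow> f \<in> borel_measurable (lebesgue_on \<Omega>) \<and>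
      integrable (lebesgue_on \<Omega>) (\<lambda>x. norm (f x) powr p)"

definition Lnorm :: "'a::euclidean_space set \<Rightarrow> real \<Rightarrow> ('a \<Rightarrow> 'b::real_normed_vector) \<Rightarrow> real" where
  "Lnorm \<Omega> p f = (\<integral>x. norm (f x) powr p \<partial>lebesgue_on \<Omega>) powr (1 / p)"

definition weak_div :: "'a::euclidean_space set \<Rightarrow> ('a \<Rightarrow> 'a) \<Rightarrow> ('a \<Rightarrow> real) \<Rightarrow> bool" where
  "weak_div \<Omega> v g \<longleftrightarrow> (\<forall>\<phi>. test_fun \<Omega> \<phi> \<longrightarrow>
      (\<integral>x. frechet_derivative \<phi> (at x) (v x) \<partial>lebesgue_on \<Omega>)
        = - (\<integral>x. g x * \<phi> x \<partial>lebesgue_on \<Omega>))"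

definition Vsp :: "'a::euclidean_space set \<Rightarrow> real \<Rightarrow> ('a \<Rightarrow> 'a) set" where
  "Vsp \<Omega> s = {v. Lp \<Omega> s v \<and> (\<exists>g. Lp \<Omega> s g \<and> weak_div \<Omega> v g)}"

definition wdiv :: "'a::euclidean_space set \<Rightarrow> real \<Rightarrow> ('a \<Rightarrow> 'a) \<Rightarrow> ('a \<Rightarrow> real)" where
  "wdiv \<Omega> s v = (SOME g. Lp \<Omega> s g \<and> weak_div \<Omega> v g)"

definition Vnorm :: "'a::euclidean_space set \<Rightarrow> real \<Rightarrow> ('a \<Rightarrow> 'a) \<Rightarrow> real" where
  "Vnorm \<Omega> s v = (Lnorm \<Omega> s v powr s + Lnorm \<Omega> s (wdiv \<Omega> s v) powr s) powr (1 / s)"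

definition conj_exp :: "real \<Rightarrow> real" where
  "conj_exp s = s / (s - 1)"

definition Wsp :: "'a::euclidean_space set \<Rightarrow> real \<Rightarrow> (('a \<Rightarrow> 'a) \<times> ('a \<Rightarrow> real)) set" where
  "Wsp \<Omega> s = Vsp \<Omega> s \<times> {q. Lp \<Omega> (conj_exp s) q}"

definition Wnorm :: "'a::euclidean_space set \<Rightarrow> real \<Rightarrow> ('a \<Rightarrow> 'a) \<times> ('a \<Rightarrow> real) \<Rightarrow> real" where
  "Wnorm \<Omega> s w = Vnorm \<Omega> s (fst w) + Lnorm \<Omega> (conj_exp s) (snd w)"

definition Wdual :: "'a::euclidean_space set \<Rightarrow> real \<Rightarrow> ((('a \<Rightarrow> 'a) \<times> ('a \<Rightarrow> real)) \<Rightarrow> real) set" where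
  "Wdual \<Omega> s = {G.
     (\<forall>v1 q1 v2 q2 a b. (v1, q1) \<in> Wsp \<Omega> s \<longrightarrow> (v2, q2) \<in> Wsp \<Omega> s \<longrightarrow>
        G (\<lambda>x. a *\<^sub>R v1 x + b *\<^sub>R v2 x, \<lambda>x. a * q1 x + b * q2 x) = a * G (v1, q1) + b * G (v2, q2))
     \<and> (\<exists>C. \<forall>w\<in>Wsp \<Omega> s. \<bar>G w\<bar> \<le> C * Wnorm \<Omega> s w)}"

definition Wdual_norm :: "'a::euclidean_space set \<Rightarrow> real \<Rightarrow> ((('a \<Rightarrow> 'a) \<times> ('a \<Rightarrow> real)) \<Rightarrow> real) \<Rightarrow> real" where
  "Wdual_norm \<Omega> s G = Sup ((\<lambda>w. \<bar>G w\<bar>) ` {w\<in>Wsp \<Omega> s. Wnorm \<Omega> s w \<le> 1})"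

definition pi1_norm :: "'a::euclidean_space set \<Rightarrow> real \<Rightarrow> ((('a \<Rightarrow> 'a) \<times> ('a \<Rightarrow> real)) \<Rightarrow> real) \<Rightarrow> real" where
  "pi1_norm \<Omega> s G = Sup ((\<lambda>v. \<bar>G (v, \<lambda>x. 0)\<bar>) ` {v\<in>Vsp \<Omega> s. Vnorm \<Omega> s v \<le> 1})"

definition pi2_norm :: "'a::euclidean_space set \<Rightarrow> real \<Rightarrow> ((('a \<Rightarrow> 'a) \<times> ('a \<Rightarrow> real)) \<Rightarrow> real) \<Rightarrow> real" where
  "pi2_norm \<Omega> s G = Sup ((\<lambda>q. \<bar>G (\<lambda>x. 0, q)\<bar>) `
      {q. Lp \<Omega> (conj_exp s) q \<and> Lnorm \<Omega> (conj_exp s) q \<le> 1})"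

definition form_a :: "'a::euclidean_space set \<Rightarrow> ('a \<Rightarrow> 'a) \<Rightarrow> ('a \<Rightarrow> 'a) \<Rightarrow> ('a \<Rightarrow> 'a) \<Rightarrow> real" where
  "form_a \<Omega> F u v = (\<integral>x. F (u x) \<bullet> v x \<partial>lebesgue_on \<Omega>)"

definition form_b :: "'a::euclidean_space set \<Rightarrow> real \<Rightarrow> ('a \<Rightarrow> 'a) \<Rightarrow> ('a \<Rightarrow> real) \<Rightarrow> real" where
  "form_b \<Omega> s v q = (\<integral>x. wdiv \<Omega> s v x * q x \<partial>lebesgue_on \<Omega>)"

definition opA :: "'a::euclidean_space set \<Rightarrow> real \<Rightarrow> ('a \<Rightarrow> 'a) \<Rightarrow> ('a \<Rightarrow> 'a) \<times> ('a \<Rightarrow> real)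
    \<Rightarrow> ('a \<Rightarrow> 'a) \<times> ('a \<Rightarrow> real) \<Rightarrow> real" where
  "opA \<Omega> s F w z = form_a \<Omega> F (fst w) (fst z) - form_b \<Omega> s (fst z) (snd w) + form_b \<Omega> s (fst w) (snd z)"

definition solves :: "'a::euclidean_space set \<Rightarrow> real \<Rightarrow> ('a \<Rightarrow> 'a) \<Rightarrow> ('a \<Rightarrow> 'a) \<times> ('a \<Rightarrow> real)
    \<Rightarrow> ((('a \<Rightarrow> 'a) \<times> ('a \<Rightarrow> real)) \<Rightarrow> real) \<Rightarrow> bool" where
  "solves \<Omega> s F w G \<longleftrightarrow> (\<forall>z\<in>Wsp \<Omega> s. opA \<Omega> s F w z = G z)"

end

theory Submission
  imports Defs
begin

text \<open>
  Testing the equation with \<open>(0, q)\<close> bounds \<open>div u\<close>, as a functional on \<open>L\<^sup>r(\<Omega>)\<close>, by \<open>\<gamma>\<close>.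
  The divergence has a bounded right inverse on \<open>L\<^sup>s(\<Omega>)\<close>: extend \<open>w\<close> by zero and integrate it along a
  coordinate direction.  Testing with \<open>(v, 0)\<close>, where \<open>div v = w\<close>, bounds \<open>p\<close> as a functional on \<open>L\<^sup>s(\<Omega>)\<close>:
  \<open>\<parallel>p\<parallel> \<le> K (\<parallel>u\<parallel> + \<parallel>u\<parallel>\<^sup>s\<^sup>-\<^sup>1 + \<beta>)\<close>.  Testing with \<open>(u, 0)\<close> gives
  \<open>c\<^sub>2 \<parallel>u\<parallel>\<^sup>s \<le> \<beta> (\<parallel>u\<parallel> + \<parallel>div u\<parallel>) + \<parallel>div u\<parallel> \<parallel>p\<parallel>\<close>.  The three inequalities together imply all bounds.
  Because \<open>wdiv\<close> is chosen by Hilbert's epsilon, homogeneity of the norm of \<open>V\<close> and the identification of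
  \<open>div v\<close> rest on uniqueness of weak divergences, i.e. on the fundamental lemma of the calculus of variations.
\<close>

section \<open>Test functions\<close>

lemma smooth_fun_coinduct:
  assumes "P f"
    and deriv: "\<And>g. P g \<Longrightarrow> \<exists>D. (\<forall>x. (g has_derivative D x) (at x)) \<and> (\<forall>i\<in>Basis. P (\<lambda>x. D x i))"
  shows "smooth_fun f"
proof -
  have "Ck k g UNIV" if "P g" for k g
    using that
  proof (induction k arbitrary: g)
    case 0
    then show ?case
      using deriv[OF 0] by (auto simp: continuous_on_eq_continuous_within intro: has_derivative_continuous)
  next
    case (Suc k)
    obtain D where D: "\<And>x. (g has_derivative D x) (at x)" "\<And>i. i \<in> Basis \<Longrightarrow> P (\<lambda>x. D x i)"
      using deriv[OF Suc.prems] by blast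
    have "frechet_derivative g (at x) = D x" for x
      using frechet_derivative_at[OF D(1)[of x]] by simp
    moreover have "g differentiable_on UNIV"
      using D(1) by (auto simp: differentiable_on_def differentiable_def)
    ultimately show ?case using Suc.IH[OF D(2)] by simp
  qed
  with \<open>P f\<close> show ?thesis by (simp add: smooth_fun_def)
qed

lemma bounded_range_if_zero_outside_compact:
  fixes f :: "'a::topological_space \<Rightarrow> 'b::real_normed_vector"
  assumes "continuous_on UNIV f" "compact K" "\<And>x. x \<notin> K \<Longrightarrow> f x = 0"
  shows "bounded (range f)"
proof (rule bounded_subset)
  show "bounded (insert 0 (f ` K))"
    using assms(1,2)
    by (auto intro!: compact_imp_bounded compact_continuous_image intro: continuous_on_subset)
qed (use assms(3) in auto)

lemma test_fun_compact_support:
  assumes "test_fun \<Omega> \<phi>"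
  obtains K where "compact K" "K \<subseteq> \<Omega>" "\<And>x. x \<notin> K \<Longrightarrow> \<phi> x = 0"
    "\<And>x. x \<notin> K \<Longrightarrow> frechet_derivative \<phi> (at x) = (\<lambda>h. 0)"
proof -
  define K where "K = closure {x. \<phi> x \<noteq> 0}"
  have K: "compact K" "K \<subseteq> \<Omega>" using assms by (auto simp: test_fun_def K_def)
  have zero: "\<phi> x = 0" if "x \<notin> K" for x
    using that closure_subset[of "{x. \<phi> x \<noteq> 0}"] by (auto simp: K_def)
  have "frechet_derivative \<phi> (at x) = (\<lambda>h. 0)" if "x \<notin> K" for x
  proof -
    have "((\<lambda>x. 0) has_derivative (\<lambda>h. 0)) (at x)" by simp
    then have "(\<phi> has_derivative (\<lambda>h. 0)) (at x)"
      by (rule has_derivative_transform_within_open[of _ _ _ _ "- K"])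
         (use that K(1) zero in \<open>auto simp: compact_imp_closed open_Compl\<close>)
    then show ?thesis by (rule frechet_derivative_at[symmetric])
  qed
  with K zero that show thesis by blast
qed

lemma test_fun_eq_0: "test_fun \<Omega> \<phi> \<Longrightarrow> x \<notin> \<Omega> \<Longrightarrow> \<phi> x = 0"
  by (metis subsetD test_fun_compact_support)

lemma test_fun_frechet_derivative_eq_0:
  "test_fun \<Omega> \<phi> \<Longrightarrow> x \<notin> \<Omega> \<Longrightarrow> frechet_derivative \<phi> (at x) = (\<lambda>h. 0)"
  by (metis subsetD test_fun_compact_support)

lemma test_fun_Ck: "test_fun \<Omega> \<phi> \<Longrightarrow> Ck k \<phi> UNIV"
  by (simp add: test_fun_def smooth_fun_def)

lemma test_fun_has_derivative: "test_fun \<Omega> \<phi> \<Longrightarrow> (\<phi> has_derivative frechet_derivative \<phi> (at x)) (at x)"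
  using test_fun_Ck[of \<Omega> \<phi> "Suc 0"] by (simp add: differentiable_on_def frechet_derivative_works)

lemma test_fun_continuous: "test_fun \<Omega> \<phi> \<Longrightarrow> continuous_on UNIV \<phi>"
  using test_fun_Ck[of \<Omega> \<phi> 0] by simp

lemma test_fun_borel_measurable: "test_fun \<Omega> \<phi> \<Longrightarrow> \<phi> \<in> borel_measurable borel"
  by (intro borel_measurable_continuous_onI test_fun_continuous)

lemma test_fun_frechet_derivative_continuous:
  "test_fun \<Omega> \<phi> \<Longrightarrow> i \<in> Basis \<Longrightarrow> continuous_on UNIV (\<lambda>x. frechet_derivative \<phi> (at x) i)"
  using test_fun_Ck[of \<Omega> \<phi> "Suc 0"] by simp

lemma test_fun_bounded: "test_fun \<Omega> \<phi> \<Longrightarrow> bounded (range \<phi>)"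
  by (metis bounded_range_if_zero_outside_compact test_fun_compact_support test_fun_continuous)

lemma test_fun_frechet_derivative_bounded:
  assumes "test_fun \<Omega> \<phi>" "i \<in> Basis"
  shows "bounded (range (\<lambda>x. frechet_derivative \<phi> (at x) i))"
proof -
  obtain K where "compact K" "\<And>x. x \<notin> K \<Longrightarrow> frechet_derivative \<phi> (at x) = (\<lambda>h. 0)"
    using test_fun_compact_support[OF assms(1)] by metis
  then show ?thesis
    using test_fun_frechet_derivative_continuous[OF assms]
    by (intro bounded_range_if_zero_outside_compact) auto
qed

section \<open>Smooth bump functions on boxes\<close>

definition flat_exp :: "nat \<Rightarrow> real \<Rightarrow> real" where
  "flat_exp m t = (if t \<le> 0 then 0 else inverse t ^ m / exp (inverse t))"

lemma flat_exp_has_derivative_at_0: "(flat_exp m has_real_derivative 0) (at 0)"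
proof -
  have "((\<lambda>y. y ^ Suc m / exp y) \<longlongrightarrow> (0::real)) at_top"
    by (rule tendsto_power_div_exp_0)
  then have "((\<lambda>h. inverse h ^ Suc m / exp (inverse h)) \<longlongrightarrow> (0::real)) (at_right 0)"
    by (rule filterlim_compose[OF _ filterlim_inverse_at_top_right])
  moreover have "\<forall>\<^sub>F h in at_right 0. inverse h ^ Suc m / exp (inverse h)
      = (flat_exp m (0 + h) - flat_exp m 0) / h"
    by (rule eventually_mono[OF eventually_at_right_less]) (auto simp: flat_exp_def field_simps)
  ultimately have "((\<lambda>h. (flat_exp m (0 + h) - flat_exp m 0) / h) \<longlongrightarrow> 0) (at_right 0)"
    by (rule Lim_transform_eventually)
  moreover have "((\<lambda>h. (flat_exp m (0 + h) - flat_exp m 0) / h) \<longlongrightarrow> 0) (at_left 0)"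
    by (rule tendsto_eventually) (auto simp: flat_exp_def eventually_at_filter)
  ultimately have "((\<lambda>h. (flat_exp m (0 + h) - flat_exp m 0) / h) \<longlongrightarrow> 0) (at 0)"
    by (rule filterlim_split_at_real[OF _ _, rotated])
  then show ?thesis by (simp add: DERIV_def)
qed

lemma flat_exp_has_derivative:
  "(flat_exp m has_real_derivative flat_exp (m + 2) t - real m * flat_exp (m + 1) t) (at t)"
proof (cases t "0::real" rule: linorder_cases)
  case less
  have "\<forall>\<^sub>F y in nhds t. flat_exp m y = 0"
    using less by (auto simp: flat_exp_def intro!: eventually_nhds_in_open[of "{..<0}", THEN eventually_mono])
  then have "(flat_exp m has_real_derivative 0) (at t)"
    using DERIV_cong_ev[OF refl, of "flat_exp m" "\<lambda>_. 0" t 0 0] by simp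
  then show ?thesis using less by (simp add: flat_exp_def)
next
  case greater
  have "((\<lambda>t. inverse t ^ m / exp (inverse t)) has_real_derivative
      flat_exp (m + 2) t - real m * flat_exp (m + 1) t) (at t)"
    using greater power_minus_mult[of _ t]
    by (cases m) (auto intro!: derivative_eq_intros simp: flat_exp_def field_simps power2_eq_square, metis neq0_conv)
  moreover have "\<forall>\<^sub>F y in nhds t. flat_exp m y = inverse y ^ m / exp (inverse y)"
    using greater by (auto simp: flat_exp_def intro!: eventually_nhds_in_open[of "{0<..}", THEN eventually_mono])
  ultimately show ?thesis
    using DERIV_cong_ev[OF refl _ refl, of "flat_exp m" "\<lambda>t. inverse t ^ m / exp (inverse t)" t] by blast
qed (use flat_exp_has_derivative_at_0 in \<open>simp add: flat_exp_def\<close>)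

inductive flat_algebra :: "('a::euclidean_space \<Rightarrow> real) \<Rightarrow> bool" where
  const: "flat_algebra (\<lambda>x. c)"
| flat: "flat_algebra (\<lambda>x. flat_exp m (v \<bullet> x + d))"
| add: "flat_algebra f \<Longrightarrow> flat_algebra g \<Longrightarrow> flat_algebra (\<lambda>x. f x + g x)"
| mult: "flat_algebra f \<Longrightarrow> flat_algebra g \<Longrightarrow> flat_algebra (\<lambda>x. f x * g x)"

lemma flat_algebra_has_derivative:
  assumes "flat_algebra f"
  shows "\<exists>D. (\<forall>x. (f has_derivative D x) (at x)) \<and> (\<forall>i. flat_algebra (\<lambda>x. D x i))"
  using assms
proof induction
  case (const c)
  show ?case by (rule exI[of _ "\<lambda>x h. 0"]) (auto intro: flat_algebra.const)
next
  case (flat m v d)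
  let ?D = "\<lambda>x h. (v \<bullet> h) * (flat_exp (m + 2) (v \<bullet> x + d) + (- real m) * flat_exp (m + 1) (v \<bullet> x + d))"
  have "((\<lambda>x. flat_exp m (v \<bullet> x + d)) has_derivative ?D x) (at x)" for x
  proof -
    have "((\<lambda>x. v \<bullet> x + d) has_derivative (\<lambda>h. v \<bullet> h)) (at x)"
      by (auto intro!: derivative_eq_intros)
    from has_derivative_compose[OF this flat_exp_has_derivative[of m, unfolded has_field_derivative_def]]
    show ?thesis by (simp add: mult.commute)
  qed
  moreover have "flat_algebra (\<lambda>x. ?D x i)" for i
    by (intro flat_algebra.intros)
  ultimately show ?case by (intro exI[of _ ?D]) blast
next
  case (add f g)
  then obtain D E where "\<forall>x. (f has_derivative D x) (at x)" "\<forall>i. flat_algebra (\<lambda>x. D x i)"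
    "\<forall>x. (g has_derivative E x) (at x)" "\<forall>i. flat_algebra (\<lambda>x. E x i)" by blast
  then show ?case
    by (intro exI[of _ "\<lambda>x h. D x h + E x h"]) (auto intro!: derivative_eq_intros flat_algebra.add)
next
  case (mult f g)
  then obtain D E where "\<forall>x. (f has_derivative D x) (at x)" "\<forall>i. flat_algebra (\<lambda>x. D x i)"
    "\<forall>x. (g has_derivative E x) (at x)" "\<forall>i. flat_algebra (\<lambda>x. E x i)" by blast
  then show ?case using mult.hyps
    by (intro exI[of _ "\<lambda>x h. f x * E x h + D x h * g x"])
       (auto intro!: derivative_eq_intros flat_algebra.add flat_algebra.mult)
qed

lemma smooth_fun_flat_algebra: "flat_algebra f \<Longrightarrow> smooth_fun f"
  by (erule smooth_fun_coinduct) (blast dest: flat_algebra_has_derivative)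

lemma flat_algebra_prod:
  assumes "finite A" "\<And>i. i \<in> A \<Longrightarrow> flat_algebra (f i)"
  shows "flat_algebra (\<lambda>x. \<Prod>i\<in>A. f i x)"
  using assms by (induction A rule: finite_induct) (auto intro: flat_algebra.intros)

definition box_bump :: "nat \<Rightarrow> 'a::euclidean_space \<Rightarrow> 'a \<Rightarrow> 'a \<Rightarrow> real" where
  "box_bump n a b x = (\<Prod>i\<in>Basis.
    flat_exp 0 (real (Suc n) * (x \<bullet> i - a \<bullet> i)) * flat_exp 0 (real (Suc n) * (b \<bullet> i - x \<bullet> i)))"

lemma smooth_fun_box_bump: "smooth_fun (box_bump n a b)"
proof -
  have "flat_algebra (\<lambda>x. flat_exp 0 (real (Suc n) * (x \<bullet> i - a \<bullet> i)))"
       "flat_algebra (\<lambda>x. flat_exp 0 (real (Suc n) * (b \<bullet> i - x \<bullet> i)))" for i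
    using flat_algebra.flat[of 0 "real (Suc n) *\<^sub>R i" "- real (Suc n) * (a \<bullet> i)"]
      flat_algebra.flat[of 0 "- (real (Suc n) *\<^sub>R i)" "real (Suc n) * (b \<bullet> i)"]
    by (simp_all add: algebra_simps inner_commute)
  then show ?thesis
    unfolding box_bump_def[abs_def]
    by (intro smooth_fun_flat_algebra flat_algebra_prod flat_algebra.mult) auto
qed

lemma flat_exp_0_nonneg: "0 \<le> flat_exp 0 t" and flat_exp_0_le_1: "flat_exp 0 t \<le> 1"
  by (auto simp: flat_exp_def)

lemma box_bump_nonneg: "0 \<le> box_bump n a b x"
  unfolding box_bump_def by (intro prod_nonneg) (auto simp: flat_exp_0_nonneg)

lemma box_bump_le_1: "box_bump n a b x \<le> 1"
  unfolding box_bump_def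
  by (intro prod_le_1) (auto simp: flat_exp_0_nonneg flat_exp_0_le_1 intro!: mult_le_one)

lemma box_bump_eq_0:
  assumes "x \<notin> box a b"
  shows "box_bump n a b x = 0"
proof -
  obtain i where i: "i \<in> Basis" "x \<bullet> i - a \<bullet> i \<le> 0 \<or> b \<bullet> i - x \<bullet> i \<le> 0"
    using assms by (auto simp: mem_box not_less)
  then have "real (Suc n) * (x \<bullet> i - a \<bullet> i) \<le> 0 \<or> real (Suc n) * (b \<bullet> i - x \<bullet> i) \<le> 0"
    by (meson mult_nonneg_nonpos of_nat_0_le_iff)
  then show ?thesis
    unfolding box_bump_def using i(1) by (intro prod_zero bexI[of _ i]) (auto simp: flat_exp_def)
qed

lemma flat_exp_0_tendsto_1:
  assumes "t > 0"
  shows "(\<lambda>n. flat_exp 0 (real (Suc n) * t)) \<longlonglongrightarrow> 1"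
proof -
  have "(\<lambda>n. exp (- (inverse (real (Suc n)) * inverse t))) \<longlonglongrightarrow> exp (- (0 * inverse t))"
    by (intro tendsto_intros LIMSEQ_inverse_real_of_nat)
  moreover have "flat_exp 0 (real (Suc n) * t) = exp (- (inverse (real (Suc n)) * inverse t))" for n
    using mult_pos_pos[OF of_nat_0_less_iff[THEN iffD2, of "Suc n"] assms]
    by (simp add: flat_exp_def exp_minus inverse_eq_divide del: of_nat_Suc)
  ultimately show ?thesis by simp
qed

lemma box_bump_tendsto_indicator: "(\<lambda>n. box_bump n a b x) \<longlonglongrightarrow> indicator (box a b) x"
proof (cases "x \<in> box a b")
  case True
  have "(\<lambda>n. box_bump n a b x) \<longlonglongrightarrow> (\<Prod>i\<in>(Basis::'a set). 1 * 1)"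
    unfolding box_bump_def using True
    by (intro tendsto_prod tendsto_mult flat_exp_0_tendsto_1) (auto simp: mem_box)
  then show ?thesis using True by simp
qed (simp add: box_bump_eq_0)

lemma test_fun_box_bump:
  assumes "cbox a b \<subseteq> \<Omega>"
  shows "test_fun \<Omega> (box_bump n a b)"
proof -
  have support: "closure {x. box_bump n a b x \<noteq> 0} \<subseteq> cbox a b"
    by (rule closure_minimal) (use box_bump_eq_0 box_subset_cbox in \<open>fastforce+\<close>)
  then have "compact (closure {x. box_bump n a b x \<noteq> 0})"
    by (metis bounded_cbox bounded_subset compact_closure closure_subset)
  then show ?thesis unfolding test_fun_def using support assms smooth_fun_box_bump by blast
qed

section \<open>The fundamental lemma of the calculus of variations\<close>

lemma measurable_lebesgue_on_borel: "f \<in> borel \<rightarrow>\<^sub>M N \<Longrightarrow> f \<in> lebesgue_on \<Omega> \<rightarrow>\<^sub>M N"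
  by (intro measurable_restrict_space1 measurable_completion) simp

lemma AE_lebesgue_on_iff_lborel:
  assumes "\<Omega> \<in> sets borel"
  shows "(AE x in lebesgue_on \<Omega>. P x) \<longleftrightarrow> (AE x in lborel. x \<in> \<Omega> \<longrightarrow> P x)"
  using assms by (subst AE_restrict_space_iff) (auto simp: AE_completion_iff)

lemma borel_representative_lebesgue_on:
  fixes f :: "'a::euclidean_space \<Rightarrow> real"
  assumes \<Omega>: "\<Omega> \<in> sets borel" and f: "f \<in> borel_measurable (lebesgue_on \<Omega>)"
  obtains g where "g \<in> borel_measurable borel" "\<And>x. x \<notin> \<Omega> \<Longrightarrow> g x = 0" "AE x in lebesgue_on \<Omega>. f x = g x"
proof -
  have "(\<lambda>x. if x \<in> \<Omega> then f x else 0) \<in> borel_measurable lebesgue"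
    using f \<Omega> by (intro borel_measurable_if_I) auto
  then obtain g where g: "g \<in> borel_measurable borel" "AE x in lborel. (if x \<in> \<Omega> then f x else 0) = g x"
    using completion_ex_borel_measurable_real[of _ lborel] by auto
  let ?g = "\<lambda>x. if x \<in> \<Omega> then g x else 0"
  have "?g \<in> borel_measurable borel" using g(1) \<Omega> by (intro measurable_If_set) auto
  moreover have "AE x in lborel. x \<in> \<Omega> \<longrightarrow> f x = ?g x" using g(2) by eventually_elim auto
  ultimately show thesis using that[of ?g] \<Omega> by (simp add: AE_lebesgue_on_iff_lborel)
qed

lemma
  fixes f :: "'a::euclidean_space \<Rightarrow> real"
  assumes \<Omega>: "\<Omega> \<in> sets borel" and f: "f \<in> borel_measurable borel" and zero: "\<And>x. x \<notin> \<Omega> \<Longrightarrow> f x = 0"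
  shows integral_lebesgue_on_eq_lborel: "(\<integral>x. f x \<partial>lebesgue_on \<Omega>) = (\<integral>x. f x \<partial>lborel)"
    and integrable_lebesgue_on_iff_lborel: "integrable (lebesgue_on \<Omega>) f \<longleftrightarrow> integrable lborel f"
proof -
  have extend: "(\<lambda>x. if x \<in> \<Omega> then f x else 0) = f" using zero by auto
  have "(\<integral>x. f x \<partial>lebesgue_on \<Omega>) = (\<integral>x. f x \<partial>lebesgue)"
    using \<Omega> Lebesgue_Measure.integral_restrict_UNIV[of \<Omega> f] by (simp add: extend)
  then show "(\<integral>x. f x \<partial>lebesgue_on \<Omega>) = (\<integral>x. f x \<partial>lborel)"
    using f by (simp add: integral_completion)
  have "integrable (lebesgue_on \<Omega>) f \<longleftrightarrow> integrable lebesgue f"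
    using \<Omega> Lebesgue_Measure.integrable_restrict_UNIV[of \<Omega> f] by (simp add: extend)
  then show "integrable (lebesgue_on \<Omega>) f \<longleftrightarrow> integrable lborel f"
    using f by (simp add: integrable_completion)
qed

lemma integrable_mult_bounded:
  fixes f g :: "'a \<Rightarrow> real"
  assumes f: "integrable M f" and g: "g \<in> borel_measurable M" "bounded (range g)"
  shows "integrable M (\<lambda>x. f x * g x)"
proof -
  obtain C where C: "\<And>x. \<bar>g x\<bar> \<le> C" using g(2) by (auto simp: bounded_iff)
  show ?thesis
  proof (rule Bochner_Integration.integrable_bound)
    show "integrable M (\<lambda>x. f x * C)" using f by simp
    show "(\<lambda>x. f x * g x) \<in> borel_measurable M" using f g by auto
    have "\<bar>f x\<bar> * \<bar>g x\<bar> \<le> \<bar>f x\<bar> * \<bar>C\<bar>" for x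
      using C[of x] by (intro mult_left_mono) auto
    then show "AE x in M. norm (f x * g x) \<le> norm (f x * C)" by (simp add: abs_mult)
  qed
qed

lemma integral_eq_0_if_box_integrals_0:
  fixes h :: "'a::euclidean_space \<Rightarrow> real"
  assumes h: "integrable lborel h" and box: "\<And>a b. (\<integral>x. indicator (box a b) x * h x \<partial>lborel) = 0"
  shows "(\<integral>x. h x \<partial>lborel) = 0"
proof -
  let ?B = "\<lambda>n. box (- (real n *\<^sub>R One)) (real n *\<^sub>R One) :: 'a set"
  have "incseq ?B"
    by (intro incseq_SucI subset_box_imp) (auto simp: algebra_simps)
  then have "(\<lambda>n. indicator (?B n) x * h x) \<longlonglongrightarrow> indicator UNIV x * h x" for x
    using LIMSEQ_indicator_incseq[of ?B x] by (intro tendsto_mult tendsto_const) (simp add: UN_box_eq_UNIV)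
  then have "(\<lambda>n. \<integral>x. indicator (?B n) x * h x \<partial>lborel) \<longlonglongrightarrow> (\<integral>x. h x \<partial>lborel)"
    using h by (intro integral_dominated_convergence[where w = "\<lambda>x. norm (h x)"])
      (auto simp: abs_mult indicator_def)
  then show ?thesis by (simp add: box LIMSEQ_const_iff)
qed

lemma AE_eq_0_if_box_integrals_0:
  fixes h :: "'a::euclidean_space \<Rightarrow> real"
  assumes h: "integrable lborel h" and box: "\<And>a b. (\<integral>x. indicator (box a b) x * h x \<partial>lborel) = 0"
  shows "AE x in lborel. h x = 0"
proof -
  let ?E = "range (\<lambda>(a, b). box a b :: 'a set)"
  have int: "set_integrable lborel A h" if "A \<in> sets borel" for A
    using that h unfolding set_integrable_def by (intro integrable_mult_indicator) auto
  have sets: "sigma_sets UNIV ?E = sets borel"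
    by (simp add: borel_eq_box)
  have zero: "(LINT x:A|lborel. h x) = 0" if "A \<in> sigma_sets UNIV ?E" for A
  proof (induction rule: sigma_sets_induct_disjoint[OF _ _ that])
    show "Int_stable ?E" by (auto simp: Int_stable_def box_Int_box)
  next
    fix A assume A: "A \<in> sigma_sets UNIV ?E" and IH: "(LINT x:A|lborel. h x) = 0"
    have "(LINT x:UNIV - A|lborel. h x) = (LINT x|lborel. h x - indicator A x *\<^sub>R h x)"
      unfolding set_lebesgue_integral_def
      by (intro Bochner_Integration.integral_cong) (auto split: split_indicator)
    also have "\<dots> = 0"
      using integral_eq_0_if_box_integrals_0[OF h box] IH h int[of A] A sets
      unfolding set_lebesgue_integral_def set_integrable_def
      by (subst Bochner_Integration.integral_diff) auto
    finally show "(LINT x:UNIV - A|lborel. h x) = 0" .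
  next
    fix A :: "nat \<Rightarrow> 'a set" assume A: "disjoint_family A" "range A \<subseteq> sigma_sets UNIV ?E"
      "\<And>i. (LINT x:A i|lborel. h x) = 0"
    then show "(LINT x:(\<Union>i. A i)|lborel. h x) = 0"
      using sets by (subst lebesgue_integral_countable_add) (auto simp: disjoint_family_on_def intro!: int)
  qed (auto simp: set_lebesgue_integral_def box)
  then show ?thesis
    using h sets by (intro density_unique_real) auto
qed

lemma AE_eq_0_on_open_if_box_integrals_0:
  fixes h :: "'a::euclidean_space \<Rightarrow> real"
  assumes \<Omega>: "open \<Omega>" and h: "integrable lborel h"
    and box: "\<And>a b. cbox a b \<subseteq> \<Omega> \<Longrightarrow> (\<integral>x. indicator (box a b) x * h x \<partial>lborel) = 0"
  shows "AE x in lborel. x \<in> \<Omega> \<longrightarrow> h x = 0"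
proof -
  have on_cbox: "AE x in lborel. x \<in> cbox c d \<longrightarrow> h x = 0" if cd: "cbox c d \<subseteq> \<Omega>" for c d
  proof -
    have "AE x in lborel. indicator (box c d) x * h x = 0"
    proof (rule AE_eq_0_if_box_integrals_0)
      show "integrable lborel (\<lambda>x. indicator (box c d) x * h x)"
        using integrable_mult_indicator[OF _ h, of "box c d"] by simp
      fix a b :: 'a
      obtain a' b' where ab': "box a b \<inter> box c d = box a' b'" "cbox a b \<inter> cbox c d = cbox a' b'"
        by (rule that[OF box_Int_box Int_interval])
      then have "(\<integral>x. indicator (box a' b') x * h x \<partial>lborel) = 0"
        using cd by (intro box) auto
      then show "(\<integral>x. indicator (box a b) x * (indicator (box c d) x * h x) \<partial>lborel) = 0"
        by (simp add: indicator_inter_arith mult.assoc flip: ab'(1))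
    qed
    moreover have "AE x in lborel. x \<notin> cbox c d - box c d"
      by (rule AE_not_in[OF null_sets_cbox_Diff_box])
    ultimately show ?thesis by eventually_elim (auto simp: indicator_def split: if_splits)
  qed
  obtain \<D> where \<D>: "countable \<D>" "\<D> \<subseteq> Pow \<Omega>" "\<And>X. X \<in> \<D> \<Longrightarrow> \<exists>a b. X = cbox a b" "\<Union>\<D> = \<Omega>"
    using open_countable_Union_open_cbox[OF \<Omega>] by metis
  have "AE x in lborel. x \<in> X \<longrightarrow> h x = 0" if "X \<in> \<D>" for X
  proof -
    obtain a b where "X = cbox a b" using \<D>(3) \<open>X \<in> \<D>\<close> by blast
    then show ?thesis using on_cbox[of a b] \<D>(2) \<open>X \<in> \<D>\<close> by blast
  qed
  then have "AE x in lborel. \<forall>X\<in>\<D>. x \<in> X \<longrightarrow> h x = 0"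
    using \<D>(1) by (subst AE_ball_countable) auto
  then show ?thesis by eventually_elim (use \<D>(4) in auto)
qed

lemma box_integral_eq_0_if_test_integrals_0:
  fixes h :: "'a::euclidean_space \<Rightarrow> real"
  assumes h: "integrable lborel h"
    and test: "\<And>\<phi>. test_fun \<Omega> \<phi> \<Longrightarrow> (\<integral>x. h x * \<phi> x \<partial>lborel) = 0" and ab: "cbox a b \<subseteq> \<Omega>"
  shows "(\<integral>x. indicator (box a b) x * h x \<partial>lborel) = 0"
proof -
  have "(\<lambda>n. \<integral>x. h x * box_bump n a b x \<partial>lborel) \<longlonglongrightarrow> (\<integral>x. h x * indicator (box a b) x \<partial>lborel)"
  proof (rule integral_dominated_convergence[where w = "\<lambda>x. norm (h x)"])
    show "AE x in lborel. (\<lambda>n. h x * box_bump n a b x) \<longlonglongrightarrow> h x * indicator (box a b) x"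
      by (intro always_eventually allI tendsto_intros box_bump_tendsto_indicator)
    show "AE x in lborel. norm (h x * box_bump n a b x) \<le> norm (h x)" for n
      by (intro always_eventually allI) (auto simp: abs_mult box_bump_nonneg box_bump_le_1 intro!: mult_left_le)
    show "(\<lambda>x. h x * box_bump n a b x) \<in> borel_measurable lborel" for n
      using h test_fun_borel_measurable[OF test_fun_box_bump[OF ab]] by simp
  qed (use h in auto)
  then show ?thesis
    by (simp add: test test_fun_box_bump[OF ab] LIMSEQ_const_iff mult.commute)
qed

lemma fundamental_lemma_calculus_of_variations:
  fixes g :: "'a::euclidean_space \<Rightarrow> real"
  assumes \<Omega>: "open \<Omega>" and g: "integrable (lebesgue_on \<Omega>) g"
    and test: "\<And>\<phi>. test_fun \<Omega> \<phi> \<Longrightarrow> (\<integral>x. g x * \<phi> x \<partial>lebesgue_on \<Omega>) = 0"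
  shows "AE x in lebesgue_on \<Omega>. g x = 0"
proof -
  have \<Omega>_borel: "\<Omega> \<in> sets borel" using \<Omega> by simp
  obtain h where h: "h \<in> borel_measurable borel" "\<And>x. x \<notin> \<Omega> \<Longrightarrow> h x = 0"
    and gh: "AE x in lebesgue_on \<Omega>. g x = h x"
    using borel_representative_lebesgue_on[OF \<Omega>_borel borel_measurable_integrable[OF g]] by blast
  have h_meas: "h \<in> borel_measurable (lebesgue_on \<Omega>)"
    using h(1) by (rule measurable_lebesgue_on_borel)
  have "integrable (lebesgue_on \<Omega>) h"
    using g gh h_meas by (subst integrable_cong_AE[of h _ g]) auto
  then have h_int: "integrable lborel h"
    using integrable_lebesgue_on_iff_lborel[OF \<Omega>_borel h] by simp
  have test_h: "(\<integral>x. h x * \<phi> x \<partial>lborel) = 0" if \<phi>: "test_fun \<Omega> \<phi>" for \<phi>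
  proof -
    note \<phi>_meas = test_fun_borel_measurable[OF \<phi>]
    have "(\<integral>x. h x * \<phi> x \<partial>lborel) = (\<integral>x. h x * \<phi> x \<partial>lebesgue_on \<Omega>)"
      using h \<phi>_meas by (intro integral_lebesgue_on_eq_lborel[OF \<Omega>_borel, symmetric]) auto
    also have "\<dots> = (\<integral>x. g x * \<phi> x \<partial>lebesgue_on \<Omega>)"
      using gh g h_meas measurable_lebesgue_on_borel[OF \<phi>_meas] by (intro integral_cong_AE) auto
    finally show ?thesis using test[OF \<phi>] by simp
  qed
  have "AE x in lborel. x \<in> \<Omega> \<longrightarrow> h x = 0"
    using AE_eq_0_on_open_if_box_integrals_0[OF \<Omega> h_int]
      box_integral_eq_0_if_test_integrals_0[OF h_int test_h] by blast
  then have "AE x in lebesgue_on \<Omega>. h x = 0"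
    by (simp add: AE_lebesgue_on_iff_lborel[OF \<Omega>_borel])
  with gh show ?thesis by eventually_elim simp
qed

section \<open>Lebesgue norms and Hoelder's inequality\<close>

lemma powr_eq_mult_powr_diff_1:
  fixes t a :: real
  assumes "t \<ge> 0"
  shows "t powr a = t * t powr (a - 1)"
  using powr_mult_base[OF assms, of "a - 1"] by simp

lemma le_if_powr_le_mult_powr:
  fixes t C a :: real
  assumes "t \<ge> 0" "C \<ge> 0" "t powr a \<le> C * t powr (a - 1)"
  shows "t \<le> C"
  using assms by (cases "t = 0") (auto simp: powr_eq_mult_powr_diff_1[of t a])

lemma conj_exp_gt_1: "s > 1 \<Longrightarrow> conj_exp s > 1"
  and conj_exp_conj_exp: "s > 1 \<Longrightarrow> conj_exp (conj_exp s) = s"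
  and inverse_add_inverse_conj_exp: "s > 1 \<Longrightarrow> 1 / s + 1 / conj_exp s = 1"
  and conj_exp_minus_1: "s > 1 \<Longrightarrow> conj_exp s - 1 = 1 / (s - 1)"
  and mult_conj_exp: "s > 1 \<Longrightarrow> (s - 1) * conj_exp s = s"
  by (auto simp: conj_exp_def field_simps)

lemma integrable_mult_if_integrable_powr:
  fixes f g :: "'a \<Rightarrow> real"
  assumes pq: "p > 1" "q > 1" "1 / p + 1 / q = 1"
    and meas[measurable]: "f \<in> borel_measurable M" "g \<in> borel_measurable M"
    and nonneg: "\<And>x. 0 \<le> f x" "\<And>x. 0 \<le> g x"
    and int: "integrable M (\<lambda>x. f x powr p)" "integrable M (\<lambda>x. g x powr q)"
  shows "integrable M (\<lambda>x. f x * g x)"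
proof (rule Bochner_Integration.integrable_bound)
  show "integrable M (\<lambda>x. f x powr p / p + g x powr q / q)"
    using int by auto
  show "AE x in M. norm (f x * g x) \<le> norm (f x powr p / p + g x powr q / q)"
    using Youngs_inequality[OF pq nonneg] nonneg
    by (intro always_eventually allI) (simp add: abs_mult order_trans[OF _ abs_ge_self])
qed simp

lemma integral_mult_le_1_if_integral_powr_eq_1:
  fixes f g :: "'a \<Rightarrow> real"
  assumes pq: "p > 1" "q > 1" "1 / p + 1 / q = 1"
    and meas: "f \<in> borel_measurable M" "g \<in> borel_measurable M"
    and nonneg: "\<And>x. 0 \<le> f x" "\<And>x. 0 \<le> g x"
    and int: "integrable M (\<lambda>x. f x powr p)" "integrable M (\<lambda>x. g x powr q)"
    and one: "(\<integral>x. f x powr p \<partial>M) = 1" "(\<integral>x. g x powr q \<partial>M) = 1"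
  shows "(\<integral>x. f x * g x \<partial>M) \<le> 1"
proof -
  have "(\<integral>x. f x * g x \<partial>M) \<le> (\<integral>x. f x powr p / p + g x powr q / q \<partial>M)"
    using int nonneg by (intro integral_mono integrable_mult_if_integrable_powr[OF pq meas nonneg int]
        Youngs_inequality[OF pq]) auto
  also have "\<dots> = 1" using int one pq(3) by simp
  finally show ?thesis .
qed

lemma integral_mult_eq_0_if_integral_powr_eq_0:
  fixes f g :: "'a \<Rightarrow> real"
  assumes "integrable M (\<lambda>x. f x powr p)" "(\<integral>x. f x powr p \<partial>M) = 0"
  shows "(\<integral>x. f x * g x \<partial>M) = 0"
proof (rule integral_eq_zero_AE)
  have "AE x in M. f x powr p = 0"
    using assms by (subst (asm) integral_nonneg_eq_0_iff_AE) auto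
  then show "AE x in M. f x * g x = 0" by eventually_elim auto
qed

lemma Hoelder_inequality:
  fixes f g :: "'a \<Rightarrow> real"
  assumes pq: "p > 1" "q > 1" "1 / p + 1 / q = 1"
    and meas: "f \<in> borel_measurable M" "g \<in> borel_measurable M"
    and nonneg: "\<And>x. 0 \<le> f x" "\<And>x. 0 \<le> g x"
    and int: "integrable M (\<lambda>x. f x powr p)" "integrable M (\<lambda>x. g x powr q)"
  shows "(\<integral>x. f x * g x \<partial>M) \<le> (\<integral>x. f x powr p \<partial>M) powr (1 / p) * (\<integral>x. g x powr q \<partial>M) powr (1 / q)"
proof -
  define A where "A = (\<integral>x. f x powr p \<partial>M)"
  define B where "B = (\<integral>x. g x powr q \<partial>M)"
  have "A \<ge> 0" "B \<ge> 0" by (auto simp: A_def B_def)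
  then consider (f_null) "A = 0" | (g_null) "B = 0" | (positive) "A > 0" "B > 0" by fastforce
  then have "(\<integral>x. f x * g x \<partial>M) \<le> A powr (1 / p) * B powr (1 / q)"
  proof cases
    case f_null
    then show ?thesis
      using integral_mult_eq_0_if_integral_powr_eq_0[OF int(1), of g] by (simp add: A_def)
  next
    case g_null
    then show ?thesis
      using integral_mult_eq_0_if_integral_powr_eq_0[OF int(2), of f] by (simp add: B_def mult.commute)
  next
    case positive
    define a where "a = A powr (1 / p)"
    define b where "b = B powr (1 / q)"
    have ab: "a > 0" "b > 0" "a powr p = A" "b powr q = B"
      using positive pq by (auto simp: a_def b_def powr_powr)
    have normalized: "(f x / a) powr p = f x powr p / A" "(g x / b) powr q = g x powr q / B" for x
      using nonneg ab by (simp_all add: powr_divide)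
    have "(\<integral>x. f x / a * (g x / b) \<partial>M) \<le> 1"
      using meas nonneg ab int positive
      by (intro integral_mult_le_1_if_integral_powr_eq_1[OF pq]) (auto simp: normalized A_def B_def)
    then have "(\<integral>x. f x * g x \<partial>M) / (a * b) \<le> 1"
      by (simp add: times_divide_times_eq)
    then show ?thesis using ab by (simp add: divide_le_eq a_def b_def)
  qed
  then show ?thesis by (simp add: A_def B_def)
qed

lemma (in finite_measure)
  fixes f :: "'a \<Rightarrow> real"
  assumes s: "s > 1" and f: "f \<in> borel_measurable M" and int: "integrable M (\<lambda>x. \<bar>f x\<bar> powr s)"
  shows integrable_if_integrable_abs_powr: "integrable M f"
    and abs_integral_powr_le:
      "\<bar>\<integral>x. f x \<partial>M\<bar> powr s \<le> measure M (space M) powr (s - 1) * (\<integral>x. \<bar>f x\<bar> powr s \<partial>M)"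
proof -
  let ?I = "\<integral>x. \<bar>f x\<bar> powr s \<partial>M" and ?m = "measure M (space M)"
  note exps = s conj_exp_gt_1[OF s] inverse_add_inverse_conj_exp[OF s]
  have meas: "(\<lambda>x. \<bar>f x\<bar>) \<in> borel_measurable M" using f by simp
  show "integrable M f"
    using integrable_mult_if_integrable_powr[OF exps meas, of "\<lambda>x. 1"] int f
    by (simp add: integrable_abs_iff)
  have "\<bar>\<integral>x. f x \<partial>M\<bar> \<le> (\<integral>x. \<bar>f x\<bar> \<partial>M)"
    using integral_norm_bound[of M f] by simp
  also have "\<dots> \<le> ?I powr (1 / s) * ?m powr (1 / conj_exp s)"
    using Hoelder_inequality[OF exps meas, of "\<lambda>x. 1"] int by simp
  finally have "\<bar>\<integral>x. f x \<partial>M\<bar> powr s \<le> (?I powr (1 / s) * ?m powr (1 / conj_exp s)) powr s"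
    using s by (intro powr_mono2) auto
  also have "\<dots> = ?m powr (s / conj_exp s) * ?I"
    using s by (simp add: powr_mult powr_powr)
  also have "s / conj_exp s = s - 1" using s by (simp add: conj_exp_def)
  finally show "\<bar>\<integral>x. f x \<partial>M\<bar> powr s \<le> ?m powr (s - 1) * ?I" .
qed

lemma Lnorm_nonneg: "0 \<le> Lnorm \<Omega> p f"
  by (simp add: Lnorm_def)

lemma Lnorm_powr:
  assumes "p > 0"
  shows "Lnorm \<Omega> p f powr p = (\<integral>x. norm (f x) powr p \<partial>lebesgue_on \<Omega>)"
  using assms by (simp add: Lnorm_def powr_powr)

lemma Lp_zero: "Lp \<Omega> p (\<lambda>x. 0)"
  by (simp add: Lp_def)

lemma Lnorm_zero: "Lnorm \<Omega> p (\<lambda>x. 0) = 0"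
  by (simp add: Lnorm_def)

lemma Lp_scaleR: "Lp \<Omega> p f \<Longrightarrow> Lp \<Omega> p (\<lambda>x. a *\<^sub>R f x)"
  by (auto simp: Lp_def powr_mult)

lemma Lnorm_scaleR:
  assumes "p > 0"
  shows "Lnorm \<Omega> p (\<lambda>x. a *\<^sub>R f x) = \<bar>a\<bar> * Lnorm \<Omega> p f"
  using assms by (simp add: Lnorm_def powr_mult powr_powr)

lemma Lnorm_cong_AE:
  assumes "f \<in> borel_measurable (lebesgue_on \<Omega>)" "g \<in> borel_measurable (lebesgue_on \<Omega>)"
    and "AE x in lebesgue_on \<Omega>. norm (f x) = norm (g x)"
  shows "Lnorm \<Omega> p f = Lnorm \<Omega> p g"
proof -
  have "(\<integral>x. norm (f x) powr p \<partial>lebesgue_on \<Omega>) = (\<integral>x. norm (g x) powr p \<partial>lebesgue_on \<Omega>)"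
    using assms by (intro integral_cong_AE) auto
  then show ?thesis by (simp add: Lnorm_def)
qed

lemma
  assumes \<Omega>: "\<Omega> \<in> sets borel" and p: "p > 0"
    and f: "f \<in> borel_measurable borel" "integrable lborel (\<lambda>x. norm (f x) powr p)"
  shows Lp_if_integrable_lborel: "Lp \<Omega> p f"
    and Lnorm_le_lborel: "Lnorm \<Omega> p f \<le> (\<integral>x. norm (f x) powr p \<partial>lborel) powr (1 / p)"
proof -
  have \<Omega>_leb: "\<Omega> \<in> sets lebesgue" using \<Omega> by auto
  have powr_meas: "(\<lambda>x. norm (f x) powr p) \<in> borel_measurable borel" using f(1) by simp
  then have int: "integrable lebesgue (\<lambda>x. norm (f x) powr p)"
    using f(2) by (simp add: integrable_completion)
  then have "integrable (lebesgue_on \<Omega>) (\<lambda>x. norm (f x) powr p)"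
    using \<Omega>_leb by (simp add: integrable_restrict_space integrable_mult_indicator del: real_scaleR_def)
  then show "Lp \<Omega> p f"
    using measurable_lebesgue_on_borel[OF f(1)] by (simp add: Lp_def)
  have "(\<integral>x. norm (f x) powr p \<partial>lebesgue_on \<Omega>) \<le> (\<integral>x. norm (f x) powr p \<partial>lebesgue_on UNIV)"
    using int \<Omega>_leb by (intro integral_mono_lebesgue_on_AE) (auto simp: lebesgue_on_UNIV_eq)
  also have "\<dots> = (\<integral>x. norm (f x) powr p \<partial>lborel)"
    using powr_meas by (simp add: lebesgue_on_UNIV_eq integral_completion)
  finally show "Lnorm \<Omega> p f \<le> (\<integral>x. norm (f x) powr p \<partial>lborel) powr (1 / p)"
    unfolding Lnorm_def using p by (intro powr_mono2) auto
qed

lemma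
  assumes pq: "p > 1" "q > 1" "1 / p + 1 / q = 1" and f: "Lp \<Omega> p f" and g: "Lp \<Omega> q g"
  shows Lp_Hoelder_integrable: "integrable (lebesgue_on \<Omega>) (\<lambda>x. norm (f x) * norm (g x))"
    and Lp_Hoelder: "(\<integral>x. norm (f x) * norm (g x) \<partial>lebesgue_on \<Omega>) \<le> Lnorm \<Omega> p f * Lnorm \<Omega> q g"
  using integrable_mult_if_integrable_powr[OF pq, of "\<lambda>x. norm (f x)" "lebesgue_on \<Omega>" "\<lambda>x. norm (g x)"]
    Hoelder_inequality[OF pq, of "\<lambda>x. norm (f x)" "lebesgue_on \<Omega>" "\<lambda>x. norm (g x)"] f g
  by (auto simp: Lp_def Lnorm_def)

lemma
  assumes \<Omega>: "\<Omega> \<in> lmeasurable" and r: "1 \<le> r" "r < s" and f: "Lp \<Omega> s f"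
  shows Lp_antimono: "Lp \<Omega> r f"
    and Lnorm_le_measure_mult_Lnorm: "Lnorm \<Omega> r f \<le> measure lebesgue \<Omega> powr (1 / r - 1 / s) * Lnorm \<Omega> s f"
proof -
  interpret finite_measure "lebesgue_on \<Omega>"
    using \<Omega> by (rule finite_measure_lebesgue_on)
  let ?I = "\<lambda>q. \<integral>x. norm (f x) powr q \<partial>lebesgue_on \<Omega>" and ?m = "measure lebesgue \<Omega>"
  have exp_gt_1: "s / r > 1" using r by simp
  have meas: "(\<lambda>x. norm (f x) powr r) \<in> borel_measurable (lebesgue_on \<Omega>)"
    using f by (auto simp: Lp_def)
  have powr_exp: "\<bar>norm (f x) powr r\<bar> powr (s / r) = norm (f x) powr s" for x
    using r by (simp add: powr_powr)
  have int: "integrable (lebesgue_on \<Omega>) (\<lambda>x. \<bar>norm (f x) powr r\<bar> powr (s / r))"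
    unfolding powr_exp using f by (simp add: Lp_def)
  show "Lp \<Omega> r f"
    using integrable_if_integrable_abs_powr[OF exp_gt_1 meas int] f by (simp add: Lp_def)
  have "?I r powr (s / r) \<le> ?m powr (s / r - 1) * ?I s"
    using abs_integral_powr_le[OF exp_gt_1 meas int] \<Omega> unfolding powr_exp by (simp add: measure_restrict_space)
  then have "(?I r powr (s / r)) powr (1 / s) \<le> (?m powr (s / r - 1) * ?I s) powr (1 / s)"
    using r by (intro powr_mono2) auto
  also have "\<dots> = ?m powr ((s / r - 1) * (1 / s)) * Lnorm \<Omega> s f"
    by (simp add: powr_mult powr_powr Lnorm_def)
  also have "(s / r - 1) * (1 / s) = 1 / r - 1 / s" using r by (simp add: field_simps)
  finally show "Lnorm \<Omega> r f \<le> ?m powr (1 / r - 1 / s) * Lnorm \<Omega> s f"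
    using r by (simp add: Lnorm_def powr_powr)
qed

lemma Lp_imp_integrable:
  fixes g :: "'a::euclidean_space \<Rightarrow> real"
  assumes "\<Omega> \<in> lmeasurable" "s > 1" "Lp \<Omega> s g"
  shows "integrable (lebesgue_on \<Omega>) g"
  using Lp_antimono[OF assms(1) _ assms(2,3)] by (auto simp: Lp_def integrable_abs_iff)

lemma
  assumes p: "p > 1" and f: "Lp \<Omega> p f" and g: "g \<in> borel_measurable (lebesgue_on \<Omega>)"
    and norm_eq: "\<And>x. norm (g x) = norm (f x) powr (p - 1)"
  shows Lp_conj_exp_if_norm_eq_powr: "Lp \<Omega> (conj_exp p) g"
    and Lnorm_conj_exp_if_norm_eq_powr: "Lnorm \<Omega> (conj_exp p) g = Lnorm \<Omega> p f powr (p - 1)"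
proof -
  have powr_conj: "norm (g x) powr conj_exp p = norm (f x) powr p" for x
    using p by (simp add: norm_eq powr_powr mult_conj_exp)
  show "Lp \<Omega> (conj_exp p) g"
    using f g by (simp add: Lp_def powr_conj)
  have "(p - 1) / p = 1 / conj_exp p" using p by (simp add: conj_exp_def)
  then show "Lnorm \<Omega> (conj_exp p) g = Lnorm \<Omega> p f powr (p - 1)"
    using p by (simp add: Lnorm_def powr_conj powr_powr)
qed

definition duality_map :: "real \<Rightarrow> real \<Rightarrow> real" where
  "duality_map p t = sgn t * \<bar>t\<bar> powr (p - 1)"

lemma abs_duality_map: "\<bar>duality_map p t\<bar> = \<bar>t\<bar> powr (p - 1)"
  by (simp add: duality_map_def abs_mult abs_sgn_eq)

lemma mult_duality_map: "t * duality_map p t = \<bar>t\<bar> powr p"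
  using powr_eq_mult_powr_diff_1[of "\<bar>t\<bar>" p] by (simp add: duality_map_def sgn_if)

lemma borel_measurable_duality_map [measurable]: "duality_map p \<in> borel_measurable borel"
  unfolding duality_map_def[abs_def] by measurable

lemma Lnorm_le_if_dual_bound:
  assumes p: "p > 1" and f: "Lp \<Omega> p f" and C: "C \<ge> 0"
    and bound: "\<And>g. Lp \<Omega> (conj_exp p) g \<Longrightarrow> (\<integral>x. f x * g x \<partial>lebesgue_on \<Omega>) \<le> C * Lnorm \<Omega> (conj_exp p) g"
  shows "Lnorm \<Omega> p f \<le> C"
proof (rule le_if_powr_le_mult_powr[OF Lnorm_nonneg C])
  let ?g = "\<lambda>x. duality_map p (f x)"
  have g: "?g \<in> borel_measurable (lebesgue_on \<Omega>)" "norm (?g x) = norm (f x) powr (p - 1)" for x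
    using f by (auto simp: Lp_def abs_duality_map
        intro: measurable_compose[OF _ borel_measurable_duality_map])
  have "Lnorm \<Omega> p f powr p = (\<integral>x. f x * ?g x \<partial>lebesgue_on \<Omega>)"
    using p by (simp add: Lnorm_powr mult_duality_map)
  also have "\<dots> \<le> C * Lnorm \<Omega> p f powr (p - 1)"
    using bound[OF Lp_conj_exp_if_norm_eq_powr[OF p f g]]
    by (simp add: Lnorm_conj_exp_if_norm_eq_powr[OF p f g])
  finally show "Lnorm \<Omega> p f powr p \<le> C * Lnorm \<Omega> p f powr (p - 1)" .
qed

section \<open>Averages of translates\<close>

lemma
  fixes f :: "'a::euclidean_space \<Rightarrow> real"
  assumes "f \<in> borel_measurable borel"
  shows integral_lborel_translation: "(\<integral>x. f (x + c) \<partial>lborel) = (\<integral>x. f x \<partial>lborel)"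
    and integrable_lborel_translation: "integrable lborel (\<lambda>x. f (x + c)) \<longleftrightarrow> integrable lborel f"
  using integral_distr[of "(+) c" lborel borel f] integrable_distr_eq[of "(+) c" lborel borel f] assms
  by (simp_all add: lborel_distr_plus add.commute[of c])

text \<open>
  Integrating over translates, instead of slicing along a coordinate, makes Fubini's theorem and
  translation invariance of \<open>lborel\<close> sufficient.
\<close>

locale finite_translations = finite_measure M for M :: "'b measure" +
  fixes shift :: "'b \<Rightarrow> 'a::euclidean_space"
  assumes measurable_shift [measurable]: "shift \<in> borel_measurable M"
begin

sublocale pair_sigma_finite M "lborel :: 'a measure" ..

definition translates_integral :: "('a \<Rightarrow> real) \<Rightarrow> 'a \<Rightarrow> real" where
  "translates_integral w x = (\<integral>t. w (x - shift t) \<partial>M)"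

lemma borel_measurable_translates_integral:
  assumes [measurable]: "w \<in> borel_measurable borel"
  shows "translates_integral w \<in> borel_measurable borel"
  unfolding translates_integral_def[abs_def] by measurable

lemma integrable_translates:
  fixes w :: "'a \<Rightarrow> real"
  assumes w[measurable]: "w \<in> borel_measurable borel" and int: "integrable lborel w"
  shows "integrable (M \<Otimes>\<^sub>M lborel) (\<lambda>(t, x). w (x - shift t))"
proof (rule Fubini_integrable)
  have "(\<integral>x. \<bar>w (x - shift t)\<bar> \<partial>lborel) = (\<integral>x. \<bar>w x\<bar> \<partial>lborel)" for t
    using integral_lborel_translation[of "\<lambda>x. \<bar>w x\<bar>" "- shift t"] by simp
  then show "integrable M (\<lambda>t. \<integral>x. norm (case (t, x) of (t, x) \<Rightarrow> w (x - shift t)) \<partial>lborel)"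
    by simp
  show "AE t in M. integrable lborel (\<lambda>x. case (t, x) of (t, x) \<Rightarrow> w (x - shift t))"
    using integrable_lborel_translation[OF w] int by (simp flip: add_uminus_conv_diff)
qed measurable

lemma integral_translates_integral:
  assumes w: "w \<in> borel_measurable borel" and int: "integrable lborel w"
  shows "(\<integral>x. translates_integral w x \<partial>lborel) = measure M (space M) * (\<integral>x. w x \<partial>lborel)"
proof -
  have "(\<integral>x. translates_integral w x \<partial>lborel) = (\<integral>t. (\<integral>x. w (x - shift t) \<partial>lborel) \<partial>M)"
    unfolding translates_integral_def by (rule Fubini_integral[OF integrable_translates[OF w int]])
  also have "\<dots> = (\<integral>t. (\<integral>x. w x \<partial>lborel) \<partial>M)"
    using integral_lborel_translation[OF w] by (simp flip: add_uminus_conv_diff)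
  finally show ?thesis by simp
qed

lemma
  assumes s: "s > 1" and w[measurable]: "w \<in> borel_measurable borel"
    and int: "integrable lborel (\<lambda>x. \<bar>w x\<bar> powr s)"
  shows integrable_translates_integral_powr: "integrable lborel (\<lambda>x. \<bar>translates_integral w x\<bar> powr s)"
    and integral_translates_integral_powr_le:
      "(\<integral>x. \<bar>translates_integral w x\<bar> powr s \<partial>lborel)
        \<le> measure M (space M) powr s * (\<integral>x. \<bar>w x\<bar> powr s \<partial>lborel)"
proof -
  let ?m = "measure M (space M)" and ?W = "translates_integral (\<lambda>x. \<bar>w x\<bar> powr s)"
  note [measurable] = borel_measurable_translates_integral[OF w]
  have translates: "integrable (M \<Otimes>\<^sub>M lborel) (\<lambda>(t, x). \<bar>w (x - shift t)\<bar> powr s)"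
    using integrable_translates[of "\<lambda>x. \<bar>w x\<bar> powr s"] int by simp
  have W_int: "integrable lborel (\<lambda>x. ?m powr (s - 1) * ?W x)"
    unfolding translates_integral_def using integrable_snd[OF translates] by simp
  have "AE x in lborel. integrable M (\<lambda>t. \<bar>w (x - shift t)\<bar> powr s)"
    by (rule AE_integrable_snd[OF translates])
  then have bound: "AE x in lborel. \<bar>translates_integral w x\<bar> powr s \<le> ?m powr (s - 1) * ?W x"
  proof eventually_elim
    case (elim x)
    show ?case
      unfolding translates_integral_def using elim by (intro abs_integral_powr_le[OF s]) auto
  qed
  show powr_int: "integrable lborel (\<lambda>x. \<bar>translates_integral w x\<bar> powr s)"
    by (rule Bochner_Integration.integrable_bound[OF W_int])
       (use bound in \<open>auto elim!: eventually_mono intro: order_trans[OF _ abs_ge_self]\<close>)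
  have "(\<integral>x. \<bar>translates_integral w x\<bar> powr s \<partial>lborel) \<le> (\<integral>x. ?m powr (s - 1) * ?W x \<partial>lborel)"
    by (rule integral_mono_AE[OF powr_int W_int bound])
  also have "\<dots> = ?m powr s * (\<integral>x. \<bar>w x\<bar> powr s \<partial>lborel)"
    using integral_translates_integral[of "\<lambda>x. \<bar>w x\<bar> powr s"] int
      powr_eq_mult_powr_diff_1[of ?m s] by simp
  finally show "(\<integral>x. \<bar>translates_integral w x\<bar> powr s \<partial>lborel) \<le> ?m powr s * (\<integral>x. \<bar>w x\<bar> powr s \<partial>lborel)" .
qed

lemma integral_translates_integral_mult:
  assumes w[measurable]: "w \<in> borel_measurable borel" and int: "integrable lborel w"
    and g[measurable]: "g \<in> borel_measurable borel" and bounded: "bounded (range g)"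
  shows "(\<integral>x. translates_integral w x * g x \<partial>lborel) = (\<integral>x. w x * (\<integral>t. g (x + shift t) \<partial>M) \<partial>lborel)"
proof -
  interpret unshifted: finite_translations M "\<lambda>_. 0::'a" by unfold_locales simp
  have "integrable (M \<Otimes>\<^sub>M lborel) (\<lambda>p. (case p of (t, x) \<Rightarrow> w (x - shift t)) * g (snd p))"
    using bounded_subset[OF bounded, of "range (\<lambda>p. g (snd p))"]
    by (intro integrable_mult_bounded integrable_translates w int) auto
  then have shifted_w: "integrable (M \<Otimes>\<^sub>M lborel) (\<lambda>(t, x). w (x - shift t) * g x)"
    by (simp add: case_prod_beta')
  have "integrable (M \<Otimes>\<^sub>M lborel) (\<lambda>p. (case p of (t, x) \<Rightarrow> w (x - 0)) * g (snd p + shift (fst p)))"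
    using bounded_subset[OF bounded, of "range (\<lambda>p. g (snd p + shift (fst p)))"]
    by (intro integrable_mult_bounded unshifted.integrable_translates w int) auto
  then have shifted_g: "integrable (M \<Otimes>\<^sub>M lborel) (\<lambda>(t, x). w x * g (x + shift t))"
    by (simp add: case_prod_beta')
  have "(\<integral>x. translates_integral w x * g x \<partial>lborel) = (\<integral>x. (\<integral>t. w (x - shift t) * g x \<partial>M) \<partial>lborel)"
    by (simp add: translates_integral_def)
  also have "\<dots> = (\<integral>t. (\<integral>x. w (x - shift t) * g x \<partial>lborel) \<partial>M)"
    by (rule Fubini_integral[OF shifted_w])
  also have "\<dots> = (\<integral>t. (\<integral>x. w x * g (x + shift t) \<partial>lborel) \<partial>M)"
  proof (rule Bochner_Integration.integral_cong[OF refl])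
    show "(\<integral>x. w (x - shift t) * g x \<partial>lborel) = (\<integral>x. w x * g (x + shift t) \<partial>lborel)" for t
      using integral_lborel_translation[of "\<lambda>x. w (x - shift t) * g x" "shift t"] by simp
  qed
  also have "\<dots> = (\<integral>x. (\<integral>t. w x * g (x + shift t) \<partial>M) \<partial>lborel)"
    by (rule Fubini_integral[OF shifted_g, symmetric])
  finally show ?thesis by simp
qed

end

section \<open>A right inverse of the divergence\<close>

lemma integral_lebesgue_on_directional_derivative:
  fixes \<phi> :: "'a::euclidean_space \<Rightarrow> real"
  assumes L: "L \<ge> 0" and D: "\<And>x. (\<phi> has_derivative D x) (at x)" and D_cont: "continuous_on UNIV (\<lambda>x. D x e)"
  shows "(\<integral>t. D (x + t *\<^sub>R e) e \<partial>lebesgue_on {0..L}) = \<phi> (x + L *\<^sub>R e) - \<phi> x"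
proof -
  have "((\<lambda>t. \<phi> (x + t *\<^sub>R e)) has_vector_derivative D (x + t *\<^sub>R e) e) (at t within {0..L})" for t
  proof -
    have "((\<lambda>t. x + t *\<^sub>R e) has_vector_derivative e) (at t within {0..L})"
      by (auto intro!: derivative_eq_intros)
    from vector_derivative_diff_chain_within[OF this has_derivative_at_withinI[OF D]]
    show ?thesis by (simp add: o_def)
  qed
  from fundamental_theorem_of_calculus[OF L this]
  have "integral {0..L} (\<lambda>t. D (x + t *\<^sub>R e) e) = \<phi> (x + L *\<^sub>R e) - \<phi> x"
    by (simp add: integral_unique)
  moreover have "continuous_on {0..L} (\<lambda>t. D (x + t *\<^sub>R e) e)"
    by (rule continuous_on_compose2[OF D_cont]) (auto intro!: continuous_intros)
  ultimately show ?thesis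
    by (simp add: lebesgue_integral_eq_integral continuous_imp_integrable_real)
qed

text \<open>
  For \<open>w\<close> supported in \<open>\<Omega>\<close> and \<open>L\<close> beyond the diameter of \<open>\<Omega>\<close>, \<open>ray_integral L e w\<close> is on \<open>\<Omega>\<close> the
  antiderivative of \<open>w\<close> in direction \<open>e\<close>.
\<close>

global_interpretation ray: finite_translations "lebesgue_on {0..L}" "\<lambda>t. t *\<^sub>R e"
  for L :: real and e :: "'a::euclidean_space"
  defines ray_integral = ray.translates_integral
proof (rule finite_translations.intro)
  show "finite_measure (lebesgue_on {0..L})" by (rule finite_measure_lebesgue_on) simp
  show "finite_translations_axioms (lebesgue_on {0..L}) (\<lambda>t. t *\<^sub>R e)"
    by unfold_locales (rule measurable_lebesgue_on_borel, simp)
qed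

lemma weak_div_ray_integral:
  fixes \<Omega> :: "'a::euclidean_space set"
  assumes \<Omega>: "open \<Omega>" and L: "L \<ge> 0" and e: "e \<in> Basis"
    and far: "\<And>x. x \<in> \<Omega> \<Longrightarrow> x + L *\<^sub>R e \<notin> \<Omega>"
    and w: "w \<in> borel_measurable borel" "integrable lborel w" and w_zero: "\<And>x. x \<notin> \<Omega> \<Longrightarrow> w x = 0"
  shows "weak_div \<Omega> (\<lambda>x. ray_integral L e w x *\<^sub>R e) w"
  unfolding weak_div_def
proof (intro allI impI)
  fix \<phi> :: "'a \<Rightarrow> real" assume \<phi>: "test_fun \<Omega> \<phi>"
  have \<Omega>_borel: "\<Omega> \<in> sets borel" using \<Omega> by simp
  define D where "D x = frechet_derivative \<phi> (at x)" for x
  have D: "(\<phi> has_derivative D x) (at x)" for x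
    using test_fun_has_derivative[OF \<phi>] by (simp add: D_def)
  have D_cont: "continuous_on UNIV (\<lambda>x. D x e)" and D_bounded: "bounded (range (\<lambda>x. D x e))"
    using test_fun_frechet_derivative_continuous[OF \<phi> e] test_fun_frechet_derivative_bounded[OF \<phi> e]
    by (simp_all add: D_def)
  note meas = borel_measurable_continuous_onI[OF D_cont] ray.borel_measurable_translates_integral[OF w(1)]
    test_fun_borel_measurable[OF \<phi>]
  have "(\<integral>x. D x (ray_integral L e w x *\<^sub>R e) \<partial>lebesgue_on \<Omega>)
      = (\<integral>x. ray_integral L e w x * D x e \<partial>lebesgue_on \<Omega>)"
    using linear_cmul[OF has_derivative_linear[OF D]] by simp
  also have "\<dots> = (\<integral>x. ray_integral L e w x * D x e \<partial>lborel)"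
    using meas test_fun_frechet_derivative_eq_0[OF \<phi>]
    by (intro integral_lebesgue_on_eq_lborel[OF \<Omega>_borel] borel_measurable_times) (auto simp: D_def)
  also have "\<dots> = (\<integral>x. w x * (\<integral>t. D (x + t *\<^sub>R e) e \<partial>lebesgue_on {0..L}) \<partial>lborel)"
    using meas D_bounded by (intro ray.integral_translates_integral_mult w) auto
  also have "\<dots> = (\<integral>x. w x * (\<phi> (x + L *\<^sub>R e) - \<phi> x) \<partial>lborel)"
    by (simp add: integral_lebesgue_on_directional_derivative[OF L D D_cont])
  also have "\<dots> = (\<integral>x. - (w x * \<phi> x) \<partial>lborel)"
  proof (rule Bochner_Integration.integral_cong[OF refl])
    show "w x * (\<phi> (x + L *\<^sub>R e) - \<phi> x) = - (w x * \<phi> x)" for x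
      using far test_fun_eq_0[OF \<phi>] w_zero by (cases "x \<in> \<Omega>") auto
  qed
  also have "\<dots> = - (\<integral>x. w x * \<phi> x \<partial>lebesgue_on \<Omega>)"
    using w(1) w_zero meas by (subst integral_lebesgue_on_eq_lborel[OF \<Omega>_borel]) auto
  finally show "(\<integral>x. frechet_derivative \<phi> (at x) (ray_integral L e w x *\<^sub>R e) \<partial>lebesgue_on \<Omega>)
      = - (\<integral>x. w x * \<phi> x \<partial>lebesgue_on \<Omega>)"
    by (simp add: D_def)
qed

lemma weak_div_cong_AE:
  assumes "weak_div \<Omega> v g" and eq: "AE x in lebesgue_on \<Omega>. g x = h x"
    and meas: "g \<in> borel_measurable (lebesgue_on \<Omega>)" "h \<in> borel_measurable (lebesgue_on \<Omega>)"
  shows "weak_div \<Omega> v h"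
proof -
  have "(\<integral>x. g x * \<phi> x \<partial>lebesgue_on \<Omega>) = (\<integral>x. h x * \<phi> x \<partial>lebesgue_on \<Omega>)" if \<phi>: "test_fun \<Omega> \<phi>" for \<phi>
    using measurable_lebesgue_on_borel[OF test_fun_borel_measurable[OF \<phi>], of \<Omega>] meas eq
    by (intro integral_cong_AE borel_measurable_times) auto
  with assms(1) show ?thesis by (simp add: weak_div_def)
qed

lemma ray_integral_Lp:
  assumes \<Omega>: "\<Omega> \<in> sets borel" and s: "s > 1" and L: "L \<ge> 0" and e: "norm e = 1"
    and w: "w \<in> borel_measurable borel" "Lp \<Omega> s w" and w_zero: "\<And>x. x \<notin> \<Omega> \<Longrightarrow> w x = 0"
  shows "Lp \<Omega> s (\<lambda>x. ray_integral L e w x *\<^sub>R e)"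
    and "Lnorm \<Omega> s (\<lambda>x. ray_integral L e w x *\<^sub>R e) \<le> L * Lnorm \<Omega> s w"
proof -
  let ?v = "\<lambda>x. ray_integral L e w x *\<^sub>R e"
  have abs_powr: "(\<lambda>x. \<bar>w x\<bar> powr s) \<in> borel_measurable borel" "\<And>x. x \<notin> \<Omega> \<Longrightarrow> \<bar>w x\<bar> powr s = 0"
    using w(1) w_zero by auto
  have w_int: "integrable lborel (\<lambda>x. \<bar>w x\<bar> powr s)"
    using w(2) integrable_lebesgue_on_iff_lborel[OF \<Omega> abs_powr] by (simp add: Lp_def)
  note v_meas = ray.borel_measurable_translates_integral[OF w(1)]
  have v_int: "integrable lborel (\<lambda>x. norm (?v x) powr s)"
    using ray.integrable_translates_integral_powr[OF s w(1) w_int] e by simp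
  have v_borel: "?v \<in> borel_measurable borel" using v_meas by simp
  show "Lp \<Omega> s ?v"
    using s by (intro Lp_if_integrable_lborel[OF \<Omega> _ v_borel v_int]) simp
  have "Lnorm \<Omega> s ?v \<le> (\<integral>x. norm (?v x) powr s \<partial>lborel) powr (1 / s)"
    using s by (intro Lnorm_le_lborel[OF \<Omega> _ v_borel v_int]) simp
  also have "\<dots> \<le> (L powr s * (\<integral>x. \<bar>w x\<bar> powr s \<partial>lborel)) powr (1 / s)"
    using ray.integral_translates_integral_powr_le[OF s w(1) w_int, of L e] e s L
    by (intro powr_mono2) (auto simp: measure_restrict_space)
  also have "\<dots> = L * Lnorm \<Omega> s w"
    using s L integral_lebesgue_on_eq_lborel[OF \<Omega> abs_powr] by (simp add: Lnorm_def powr_mult powr_powr)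
  finally show "Lnorm \<Omega> s ?v \<le> L * Lnorm \<Omega> s w" .
qed

lemma weak_div_right_inverse:
  fixes \<Omega> :: "'a::euclidean_space set"
  assumes \<Omega>: "open \<Omega>" "bounded \<Omega>" and s: "s > 1" and w: "Lp \<Omega> s w"
  obtains v where "Lp \<Omega> s v" "weak_div \<Omega> v w" "Lnorm \<Omega> s v \<le> (diameter \<Omega> + 1) * Lnorm \<Omega> s w"
proof -
  let ?L = "diameter \<Omega> + 1"
  have L: "?L \<ge> 0" using diameter_ge_0[OF \<Omega>(2)] by simp
  have \<Omega>_borel: "\<Omega> \<in> sets borel" and \<Omega>_lmeasurable: "\<Omega> \<in> lmeasurable"
    using \<Omega> by (auto simp: lmeasurable_open)
  obtain e :: 'a where e: "e \<in> Basis" using nonempty_Basis by blast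
  have far: "x + ?L *\<^sub>R e \<notin> \<Omega>" if "x \<in> \<Omega>" for x
    using diameter_bounded_bound[OF \<Omega>(2) that, of "x + ?L *\<^sub>R e"] e L by (auto simp: dist_norm)
  have w_meas: "w \<in> borel_measurable (lebesgue_on \<Omega>)" using w by (simp add: Lp_def)
  obtain h where h: "h \<in> borel_measurable borel" "\<And>x. x \<notin> \<Omega> \<Longrightarrow> h x = 0"
    and wh: "AE x in lebesgue_on \<Omega>. w x = h x"
    using borel_representative_lebesgue_on[OF \<Omega>_borel w_meas] by blast
  have h_meas: "h \<in> borel_measurable (lebesgue_on \<Omega>)"
    using h(1) by (rule measurable_lebesgue_on_borel)
  have "integrable (lebesgue_on \<Omega>) (\<lambda>x. \<bar>h x\<bar> powr s)"
    using w wh h_meas by (subst integrable_cong_AE[where g = "\<lambda>x. \<bar>w x\<bar> powr s"]) (auto simp: Lp_def)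
  then have h_Lp: "Lp \<Omega> s h" using h_meas by (simp add: Lp_def)
  have "integrable lborel h"
    using Lp_imp_integrable[OF \<Omega>_lmeasurable s h_Lp] integrable_lebesgue_on_iff_lborel[OF \<Omega>_borel h] by simp
  then have "weak_div \<Omega> (\<lambda>x. ray_integral ?L e h x *\<^sub>R e) h"
    using weak_div_ray_integral[OF \<Omega>(1) L e far h(1)] h(2) by simp
  then have "weak_div \<Omega> (\<lambda>x. ray_integral ?L e h x *\<^sub>R e) w"
    using wh h_meas w_meas by (elim weak_div_cong_AE) auto
  moreover have "Lnorm \<Omega> s h = Lnorm \<Omega> s w"
    using wh by (intro Lnorm_cong_AE h_meas w_meas) auto
  ultimately show thesis
    using that ray_integral_Lp[OF \<Omega>_borel s L norm_Basis[OF e] h(1) h_Lp h(2)] by simp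
qed

section \<open>The space of fields with a weak divergence\<close>

lemma
  assumes "v \<in> Vsp \<Omega> s"
  shows Lp_wdiv: "Lp \<Omega> s (wdiv \<Omega> s v)" and weak_div_wdiv: "weak_div \<Omega> v (wdiv \<Omega> s v)"
proof -
  have "\<exists>g. Lp \<Omega> s g \<and> weak_div \<Omega> v g" using assms by (simp add: Vsp_def)
  from someI_ex[OF this] show "Lp \<Omega> s (wdiv \<Omega> s v)" "weak_div \<Omega> v (wdiv \<Omega> s v)"
    by (auto simp: wdiv_def)
qed

lemma Vsp_imp_Lp: "v \<in> Vsp \<Omega> s \<Longrightarrow> Lp \<Omega> s v"
  by (simp add: Vsp_def)

lemma VspI: "Lp \<Omega> s v \<Longrightarrow> Lp \<Omega> s g \<Longrightarrow> weak_div \<Omega> v g \<Longrightarrow> v \<in> Vsp \<Omega> s"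
  by (auto simp: Vsp_def)

lemma weak_div_unique:
  fixes \<Omega> :: "'a::euclidean_space set"
  assumes \<Omega>: "open \<Omega>" and int: "integrable (lebesgue_on \<Omega>) g" "integrable (lebesgue_on \<Omega>) h"
    and div: "weak_div \<Omega> v g" "weak_div \<Omega> v h"
  shows "AE x in lebesgue_on \<Omega>. g x = h x"
proof -
  have "AE x in lebesgue_on \<Omega>. g x - h x = 0"
  proof (rule fundamental_lemma_calculus_of_variations[OF \<Omega>])
    show "integrable (lebesgue_on \<Omega>) (\<lambda>x. g x - h x)" using int by simp
    fix \<phi> :: "'a \<Rightarrow> real" assume \<phi>: "test_fun \<Omega> \<phi>"
    have "integrable (lebesgue_on \<Omega>) (\<lambda>x. f x * \<phi> x)" if "integrable (lebesgue_on \<Omega>) f" for f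
      using that test_fun_bounded[OF \<phi>] measurable_lebesgue_on_borel[OF test_fun_borel_measurable[OF \<phi>]]
      by (intro integrable_mult_bounded)
    moreover have "(\<integral>x. g x * \<phi> x \<partial>lebesgue_on \<Omega>) = (\<integral>x. h x * \<phi> x \<partial>lebesgue_on \<Omega>)"
      using div \<phi> by (simp add: weak_div_def)
    ultimately show "(\<integral>x. (g x - h x) * \<phi> x \<partial>lebesgue_on \<Omega>) = 0"
      using int by (simp add: left_diff_distrib)
  qed
  then show ?thesis by simp
qed

lemma weak_div_scaleR:
  fixes v :: "'a::euclidean_space \<Rightarrow> 'a"
  assumes "weak_div \<Omega> v g"
  shows "weak_div \<Omega> (\<lambda>x. a *\<^sub>R v x) (\<lambda>x. a *\<^sub>R g x)"
  unfolding weak_div_def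
proof (intro allI impI)
  fix \<phi> :: "'a \<Rightarrow> real" assume \<phi>: "test_fun \<Omega> \<phi>"
  have "frechet_derivative \<phi> (at x) (a *\<^sub>R v x) = a * frechet_derivative \<phi> (at x) (v x)" for x
    using linear_cmul[OF has_derivative_linear[OF test_fun_has_derivative[OF \<phi>, of x]]] by simp
  then show "(\<integral>x. frechet_derivative \<phi> (at x) (a *\<^sub>R v x) \<partial>lebesgue_on \<Omega>)
      = - (\<integral>x. a *\<^sub>R g x * \<phi> x \<partial>lebesgue_on \<Omega>)"
    using assms \<phi> by (simp add: weak_div_def mult.assoc)
qed

lemma weak_div_zero: "weak_div \<Omega> (\<lambda>x. 0) (\<lambda>x. 0)"
  using linear_0[OF has_derivative_linear[OF test_fun_has_derivative[of \<Omega>]]] by (simp add: weak_div_def)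

lemma Vsp_zero: "(\<lambda>x. 0) \<in> Vsp \<Omega> s"
  by (rule VspI[OF Lp_zero Lp_zero weak_div_zero])

lemma Vsp_scaleR: "v \<in> Vsp \<Omega> s \<Longrightarrow> (\<lambda>x. a *\<^sub>R v x) \<in> Vsp \<Omega> s"
  by (rule VspI[OF Lp_scaleR[OF Vsp_imp_Lp] Lp_scaleR[OF Lp_wdiv] weak_div_scaleR[OF weak_div_wdiv]])

lemma powr_add_powr_root_le:
  fixes a b s :: real
  assumes "a \<ge> 0" "b \<ge> 0" "s > 1"
  shows "(a powr s + b powr s) powr (1 / s) \<le> a + b"
proof -
  note split = powr_eq_mult_powr_diff_1[of _ s]
  have "a powr s + b powr s \<le> a * (a + b) powr (s - 1) + b * (a + b) powr (s - 1)"
    unfolding split[OF assms(1)] split[OF assms(2)]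
    using assms by (intro add_mono mult_left_mono powr_mono2) auto
  also have "\<dots> = (a + b) powr s" using split[of "a + b"] assms by (simp add: distrib_right)
  finally have "(a powr s + b powr s) powr (1 / s) \<le> ((a + b) powr s) powr (1 / s)"
    using assms by (intro powr_mono2) auto
  then show ?thesis using assms by (simp add: powr_powr)
qed

lemma Vnorm_nonneg: "0 \<le> Vnorm \<Omega> s v"
  by (simp add: Vnorm_def)

lemma Vnorm_le: "s > 1 \<Longrightarrow> Vnorm \<Omega> s v \<le> Lnorm \<Omega> s v + Lnorm \<Omega> s (wdiv \<Omega> s v)"
  unfolding Vnorm_def by (intro powr_add_powr_root_le Lnorm_nonneg)

lemma Wnorm_nonneg: "0 \<le> Wnorm \<Omega> s w"
  by (simp add: Wnorm_def Vnorm_nonneg Lnorm_nonneg)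

lemma Wsp_velocityI: "v \<in> Vsp \<Omega> s \<Longrightarrow> (v, \<lambda>x. 0) \<in> Wsp \<Omega> s"
  by (simp add: Wsp_def Lp_zero)

lemma Wsp_pressureI: "Lp \<Omega> (conj_exp s) q \<Longrightarrow> (\<lambda>x. 0, q) \<in> Wsp \<Omega> s"
  by (simp add: Wsp_def Vsp_zero)

lemma Wnorm_velocity: "Wnorm \<Omega> s (v, \<lambda>x. 0) = Vnorm \<Omega> s v"
  by (simp add: Wnorm_def Lnorm_zero)

locale bounded_open_domain =
  fixes \<Omega> :: "'a::euclidean_space set" and s :: real
  assumes open_domain: "open \<Omega>" and bounded_domain: "bounded \<Omega>" and exponent_gt_1: "s > 1"
begin

lemma lmeasurable_domain: "\<Omega> \<in> lmeasurable"
  using open_domain bounded_domain by (simp add: lmeasurable_open)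

lemma wdiv_AE_eq:
  assumes v: "Lp \<Omega> s v" and g: "Lp \<Omega> s g" and div: "weak_div \<Omega> v g"
  shows "AE x in lebesgue_on \<Omega>. wdiv \<Omega> s v x = g x"
proof -
  have "v \<in> Vsp \<Omega> s" using v g div by (rule VspI)
  with g div show ?thesis
    using Lp_imp_integrable[OF lmeasurable_domain exponent_gt_1]
    by (intro weak_div_unique[OF open_domain]) (auto intro: Lp_wdiv weak_div_wdiv)
qed

lemma Lnorm_wdiv_eq:
  assumes v: "Lp \<Omega> s v" and g: "Lp \<Omega> s g" and div: "weak_div \<Omega> v g"
  shows "Lnorm \<Omega> s (wdiv \<Omega> s v) = Lnorm \<Omega> s g"
proof (rule Lnorm_cong_AE)
  show "wdiv \<Omega> s v \<in> borel_measurable (lebesgue_on \<Omega>)" "g \<in> borel_measurable (lebesgue_on \<Omega>)"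
    using Lp_wdiv[OF VspI[OF v g div]] g by (auto simp: Lp_def)
  show "AE x in lebesgue_on \<Omega>. norm (wdiv \<Omega> s v x) = norm (g x)"
    using wdiv_AE_eq[OF v g div] by eventually_elim simp
qed

lemma Vnorm_scaleR:
  assumes v: "v \<in> Vsp \<Omega> s"
  shows "Vnorm \<Omega> s (\<lambda>x. a *\<^sub>R v x) = \<bar>a\<bar> * Vnorm \<Omega> s v"
proof -
  have "Lnorm \<Omega> s (wdiv \<Omega> s (\<lambda>x. a *\<^sub>R v x)) = Lnorm \<Omega> s (\<lambda>x. a *\<^sub>R wdiv \<Omega> s v x)"
    by (rule Lnorm_wdiv_eq[OF Lp_scaleR[OF Vsp_imp_Lp[OF v]] Lp_scaleR[OF Lp_wdiv[OF v]]
          weak_div_scaleR[OF weak_div_wdiv[OF v]]])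
  then have "Vnorm \<Omega> s (\<lambda>x. a *\<^sub>R v x)
      = (\<bar>a\<bar> powr s * (Lnorm \<Omega> s v powr s + Lnorm \<Omega> s (wdiv \<Omega> s v) powr s)) powr (1 / s)"
    using exponent_gt_1 by (simp add: Vnorm_def Lnorm_scaleR powr_mult Lnorm_nonneg distrib_left
        del: real_scaleR_def)
  also have "\<dots> = \<bar>a\<bar> * Vnorm \<Omega> s v"
    unfolding Vnorm_def using exponent_gt_1 by (subst powr_mult) (auto simp: powr_powr)
  finally show ?thesis .
qed

lemma Wnorm_pressure: "Wnorm \<Omega> s (\<lambda>x. 0, q) = Lnorm \<Omega> (conj_exp s) q"
  using Vnorm_scaleR[OF Vsp_zero, of 0] by (simp add: Wnorm_def)

end

section \<open>Dual norms\<close>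

definition dual_norm :: "'v set \<Rightarrow> ('v \<Rightarrow> real) \<Rightarrow> ('v \<Rightarrow> real) \<Rightarrow> real" where
  "dual_norm X N f = Sup ((\<lambda>x. \<bar>f x\<bar>) ` {x\<in>X. N x \<le> 1})"

locale bounded_homogeneous_functional =
  fixes X :: "'v set" and N :: "'v \<Rightarrow> real" and scale :: "real \<Rightarrow> 'v \<Rightarrow> 'v" and f :: "'v \<Rightarrow> real"
  assumes nonempty: "X \<noteq> {}"
    and scale_closed: "x \<in> X \<Longrightarrow> scale a x \<in> X"
    and norm_nonneg: "x \<in> X \<Longrightarrow> 0 \<le> N x"
    and norm_scale: "x \<in> X \<Longrightarrow> N (scale a x) = \<bar>a\<bar> * N x"
    and functional_scale: "x \<in> X \<Longrightarrow> f (scale a x) = a * f x"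
    and bounded_functional: "\<exists>C. \<forall>x\<in>X. \<bar>f x\<bar> \<le> C * N x"
begin

lemma unit_ball_nonempty: "{x\<in>X. N x \<le> 1} \<noteq> {}"
proof -
  obtain x where "x \<in> X" using nonempty by blast
  then have "scale 0 x \<in> {x\<in>X. N x \<le> 1}" by (simp add: scale_closed norm_scale)
  then show ?thesis by blast
qed

lemma bdd_above_unit_ball: "bdd_above ((\<lambda>x. \<bar>f x\<bar>) ` {x\<in>X. N x \<le> 1})"
proof -
  obtain C where C: "\<And>x. x \<in> X \<Longrightarrow> \<bar>f x\<bar> \<le> C * N x" using bounded_functional by blast
  have "\<bar>f x\<bar> \<le> \<bar>C\<bar>" if "x \<in> X" "N x \<le> 1" for x
  proof -
    have "C * N x \<le> \<bar>C\<bar> * 1" using that norm_nonneg by (intro mult_mono) auto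
    then show ?thesis using C[OF \<open>x \<in> X\<close>] by simp
  qed
  then show ?thesis by (intro bdd_aboveI[of _ "\<bar>C\<bar>"]) auto
qed

lemma dual_norm_nonneg: "0 \<le> dual_norm X N f"
  unfolding dual_norm_def using unit_ball_nonempty
  by (auto intro: cSUP_upper2[OF bdd_above_unit_ball])

lemma abs_le_dual_norm_mult:
  assumes x: "x \<in> X"
  shows "\<bar>f x\<bar> \<le> dual_norm X N f * N x"
proof (cases "N x = 0")
  case True
  then show ?thesis using bounded_functional x by force
next
  case False
  then have N: "N x > 0" using norm_nonneg[OF x] by simp
  have "\<bar>f (scale (1 / N x) x)\<bar> \<le> dual_norm X N f"
    unfolding dual_norm_def using N x
    by (intro cSUP_upper[OF _ bdd_above_unit_ball]) (simp add: scale_closed norm_scale)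
  then show ?thesis using N x by (simp add: functional_scale abs_mult field_simps)
qed

lemma dual_norm_le:
  assumes C: "C \<ge> 0" "\<And>x. x \<in> X \<Longrightarrow> \<bar>f x\<bar> \<le> C * N x"
  shows "dual_norm X N f \<le> C"
  unfolding dual_norm_def
proof (rule cSUP_least[OF unit_ball_nonempty])
  fix x assume "x \<in> {x\<in>X. N x \<le> 1}"
  then show "\<bar>f x\<bar> \<le> C" using C(2)[of x] mult_left_le[OF _ C(1), of "N x"] by simp
qed

end

lemma pi1_norm_eq_dual_norm: "pi1_norm \<Omega> s G = dual_norm (Vsp \<Omega> s) (Vnorm \<Omega> s) (\<lambda>v. G (v, \<lambda>x. 0))"
  and pi2_norm_eq_dual_norm: "pi2_norm \<Omega> s G
    = dual_norm {q. Lp \<Omega> (conj_exp s) q} (Lnorm \<Omega> (conj_exp s)) (\<lambda>q. G (\<lambda>x. 0, q))"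
  and Wdual_norm_eq_dual_norm: "Wdual_norm \<Omega> s G = dual_norm (Wsp \<Omega> s) (Wnorm \<Omega> s) G"
  by (simp_all add: pi1_norm_def pi2_norm_def Wdual_norm_def dual_norm_def)

lemma Wdual_scaleR:
  assumes G: "G \<in> Wdual \<Omega> s" and w: "(v, q) \<in> Wsp \<Omega> s"
  shows "G (\<lambda>x. a *\<^sub>R v x, \<lambda>x. a *\<^sub>R q x) = a * G (v, q)"
proof -
  have "G (\<lambda>x. a *\<^sub>R v x + 0 *\<^sub>R v x, \<lambda>x. a * q x + 0 * q x) = a * G (v, q) + 0 * G (v, q)"
    using G w unfolding Wdual_def by blast
  then show ?thesis by simp
qed

lemma Wdual_zero: "G \<in> Wdual \<Omega> s \<Longrightarrow> G (\<lambda>x. 0, \<lambda>x. 0) = 0"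
  using Wdual_scaleR[OF _ Wsp_velocityI[OF Vsp_zero], of G _ _ 0] by simp

lemma Wdual_bounded: "G \<in> Wdual \<Omega> s \<Longrightarrow> \<exists>C. \<forall>w\<in>Wsp \<Omega> s. \<bar>G w\<bar> \<le> C * Wnorm \<Omega> s w"
  by (simp add: Wdual_def)

locale Wdual_functional = bounded_open_domain \<Omega> s for \<Omega> :: "'a::euclidean_space set" and s :: real +
  fixes G :: "('a \<Rightarrow> 'a) \<times> ('a \<Rightarrow> real) \<Rightarrow> real"
  assumes functional: "G \<in> Wdual \<Omega> s"
begin

sublocale full: bounded_homogeneous_functional "Wsp \<Omega> s" "Wnorm \<Omega> s"
  "\<lambda>a w. (\<lambda>x. a *\<^sub>R fst w x, \<lambda>x. a *\<^sub>R snd w x)" G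
proof
  show "Wsp \<Omega> s \<noteq> {}" using Wsp_velocityI[OF Vsp_zero] by blast
  fix w :: "('a \<Rightarrow> 'a) \<times> ('a \<Rightarrow> real)" and a :: real assume w: "w \<in> Wsp \<Omega> s"
  show "(\<lambda>x. a *\<^sub>R fst w x, \<lambda>x. a *\<^sub>R snd w x) \<in> Wsp \<Omega> s"
    using w Lp_scaleR[of \<Omega> "conj_exp s" "snd w" a] by (auto simp: Wsp_def intro: Vsp_scaleR)
  show "Wnorm \<Omega> s (\<lambda>x. a *\<^sub>R fst w x, \<lambda>x. a *\<^sub>R snd w x) = \<bar>a\<bar> * Wnorm \<Omega> s w"
    using w Vnorm_scaleR[of "fst w" a] Lnorm_scaleR[of "conj_exp s" \<Omega> a "snd w"]
      conj_exp_gt_1[OF exponent_gt_1]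
    by (auto simp: Wnorm_def Wsp_def distrib_left)
  show "G (\<lambda>x. a *\<^sub>R fst w x, \<lambda>x. a *\<^sub>R snd w x) = a * G w"
    using Wdual_scaleR[OF functional, of "fst w" "snd w"] w by simp
qed (use Wnorm_nonneg Wdual_bounded[OF functional] in auto)

sublocale pi1: bounded_homogeneous_functional "Vsp \<Omega> s" "Vnorm \<Omega> s" "\<lambda>a v x. a *\<^sub>R v x" "\<lambda>v. G (v, \<lambda>x. 0)"
proof
  show "\<exists>C. \<forall>v\<in>Vsp \<Omega> s. \<bar>G (v, \<lambda>x. 0)\<bar> \<le> C * Vnorm \<Omega> s v"
    using Wdual_bounded[OF functional] Wsp_velocityI by (fastforce simp flip: Wnorm_velocity)
  show "G (\<lambda>x. a *\<^sub>R v x, \<lambda>x. 0) = a * G (v, \<lambda>x. 0)" if "v \<in> Vsp \<Omega> s" for v a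
    using Wdual_scaleR[OF functional Wsp_velocityI[OF that], of a] by simp
qed (use Vsp_zero in \<open>auto simp: Vsp_scaleR Vnorm_nonneg Vnorm_scaleR\<close>)

sublocale pi2: bounded_homogeneous_functional "{q. Lp \<Omega> (conj_exp s) q}" "Lnorm \<Omega> (conj_exp s)"
  "\<lambda>a q x. a *\<^sub>R q x" "\<lambda>q. G (\<lambda>x. 0, q)"
proof
  show "{q :: 'a \<Rightarrow> real. Lp \<Omega> (conj_exp s) q} \<noteq> {}" using Lp_zero by blast
  show "\<exists>C. \<forall>q\<in>{q. Lp \<Omega> (conj_exp s) q}. \<bar>G (\<lambda>x. 0, q)\<bar> \<le> C * Lnorm \<Omega> (conj_exp s) q"
    using Wdual_bounded[OF functional] Wsp_pressureI by (fastforce simp flip: Wnorm_pressure)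
  fix q :: "'a \<Rightarrow> real" and a :: real assume q: "q \<in> {q. Lp \<Omega> (conj_exp s) q}"
  show "(\<lambda>x. a *\<^sub>R q x) \<in> {q. Lp \<Omega> (conj_exp s) q}"
    using Lp_scaleR q by blast
  show "Lnorm \<Omega> (conj_exp s) (\<lambda>x. a *\<^sub>R q x) = \<bar>a\<bar> * Lnorm \<Omega> (conj_exp s) q"
    using conj_exp_gt_1[OF exponent_gt_1] by (intro Lnorm_scaleR) simp
  show "G (\<lambda>x. 0, \<lambda>x. a *\<^sub>R q x) = a * G (\<lambda>x. 0, q)"
    using Wdual_scaleR[OF functional Wsp_pressureI, of q a] q by simp
qed (simp add: Lnorm_nonneg)

lemma pi1_norm_le_Wdual_norm: "pi1_norm \<Omega> s G \<le> Wdual_norm \<Omega> s G"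
  unfolding pi1_norm_eq_dual_norm Wdual_norm_eq_dual_norm
  using full.abs_le_dual_norm_mult[OF Wsp_velocityI]
  by (intro pi1.dual_norm_le full.dual_norm_nonneg) (simp add: Wnorm_velocity)

lemma pi2_norm_le_Wdual_norm: "pi2_norm \<Omega> s G \<le> Wdual_norm \<Omega> s G"
  unfolding pi2_norm_eq_dual_norm Wdual_norm_eq_dual_norm
  using full.abs_le_dual_norm_mult[OF Wsp_pressureI]
  by (intro pi2.dual_norm_le full.dual_norm_nonneg) (simp add: Wnorm_pressure)

end

section \<open>Resolution of the coupled inequalities\<close>

definition velocity_rate :: "real \<Rightarrow> real \<Rightarrow> real \<Rightarrow> real" where
  "velocity_rate s \<beta> \<gamma> = \<beta> powr (conj_exp s - 1) + \<gamma> powr (conj_exp s - 1) + \<gamma>"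

definition pressure_rate :: "real \<Rightarrow> real \<Rightarrow> real \<Rightarrow> real" where
  "pressure_rate s \<beta> \<gamma> = \<gamma> powr (conj_exp s - 1) + \<gamma> powr (s - 1) + \<beta> powr (conj_exp s - 1) + \<beta>"

lemma powr_conj_exp_powr:
  assumes "s > 1" "t \<ge> 0"
  shows "(t powr (conj_exp s - 1)) powr (s - 1) = t"
  using assms by (simp add: conj_exp_minus_1 powr_powr)

lemma le_powr_add_powr:
  fixes t a b :: real
  assumes "t \<ge> 0" "a \<le> 1" "1 \<le> b"
  shows "t \<le> t powr a + t powr b"
proof (cases "t \<le> 1")
  case True
  then have "t powr 1 \<le> t powr a" using assms by (intro powr_mono') auto
  then show ?thesis using assms by (simp add: add_increasing2)
next
  case False
  then have "t powr 1 \<le> t powr b" using assms by (intro powr_mono) auto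
  then show ?thesis using False by (simp add: add_increasing)
qed

lemma le_powr_conj_exp_add_powr:
  assumes "s \<ge> 2" "t \<ge> 0"
  shows "t \<le> t powr (conj_exp s - 1) + t powr (s - 1)"
  using assms by (intro le_powr_add_powr) (auto simp: conj_exp_minus_1)

lemma add_powr_le:
  fixes a b m :: real
  assumes "a \<ge> 0" "b \<ge> 0" "m \<ge> 0"
  shows "(a + b) powr m \<le> 2 powr m * (a powr m + b powr m)"
proof -
  have "(a + b) powr m \<le> (2 * max a b) powr m"
    using assms by (intro powr_mono2) auto
  also have "\<dots> = 2 powr m * max a b powr m"
    using assms by (simp add: powr_mult)
  also have "max a b powr m \<le> a powr m + b powr m" by (auto simp: max_def)
  finally show ?thesis by simp
qed

lemma velocity_rate_nonneg: "\<gamma> \<ge> 0 \<Longrightarrow> 0 \<le> velocity_rate s \<beta> \<gamma>"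
  by (simp add: velocity_rate_def)

lemma pressure_rate_nonneg: "\<beta> \<ge> 0 \<Longrightarrow> 0 \<le> pressure_rate s \<beta> \<gamma>"
  by (simp add: pressure_rate_def)

lemma le_pressure_rate:
  assumes "s \<ge> 2" "\<beta> \<ge> 0" "\<gamma> \<ge> 0"
  shows "\<gamma> \<le> pressure_rate s \<beta> \<gamma>"
  using le_powr_conj_exp_add_powr[OF assms(1,3)] assms(2) by (simp add: pressure_rate_def add_increasing2)

lemma velocity_rate_le_pressure_rate:
  assumes "s \<ge> 2" "\<beta> \<ge> 0" "\<gamma> \<ge> 0"
  shows "velocity_rate s \<beta> \<gamma> \<le> 2 * pressure_rate s \<beta> \<gamma>"
proof -
  have "\<beta> powr (conj_exp s - 1) + \<gamma> powr (conj_exp s - 1) \<le> pressure_rate s \<beta> \<gamma>"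
    using assms by (simp add: pressure_rate_def)
  then show ?thesis using le_pressure_rate[OF assms] by (simp add: velocity_rate_def)
qed

lemma velocity_rate_powr_le:
  assumes s: "s \<ge> 2" and nonneg: "\<beta> \<ge> 0" "\<gamma> \<ge> 0"
  shows "velocity_rate s \<beta> \<gamma> powr (s - 1) \<le> 2 * 4 powr (s - 1) * pressure_rate s \<beta> \<gamma>"
proof -
  let ?\<rho> = "conj_exp s - 1" and ?m = "s - 1"
  have "velocity_rate s \<beta> \<gamma> powr ?m \<le> 2 powr ?m * ((\<beta> powr ?\<rho> + \<gamma> powr ?\<rho>) powr ?m + \<gamma> powr ?m)"
    unfolding velocity_rate_def using s nonneg by (intro add_powr_le) auto
  also have "(\<beta> powr ?\<rho> + \<gamma> powr ?\<rho>) powr ?m \<le> 2 powr ?m * (\<beta> + \<gamma>)"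
    using add_powr_le[of "\<beta> powr ?\<rho>" "\<gamma> powr ?\<rho>" ?m] s nonneg by (simp add: powr_conj_exp_powr)
  also have "\<gamma> powr ?m \<le> 2 powr ?m * \<gamma> powr ?m"
    using s mult_right_mono[OF ge_one_powr_ge_zero[of 2 ?m]] by simp
  also have "2 powr ?m * (2 powr ?m * (\<beta> + \<gamma>) + 2 powr ?m * \<gamma> powr ?m) = 4 powr ?m * (\<beta> + \<gamma> + \<gamma> powr ?m)"
    using powr_mult[of 2 2 ?m] by (simp add: algebra_simps)
  also have "\<beta> + \<gamma> + \<gamma> powr ?m \<le> 2 * pressure_rate s \<beta> \<gamma>"
  proof -
    have "\<beta> + \<gamma> powr ?m \<le> pressure_rate s \<beta> \<gamma>" by (simp add: pressure_rate_def)
    then show ?thesis using le_pressure_rate[OF s nonneg] by simp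
  qed
  finally show ?thesis by (simp add: mult_ac)
qed

lemma pressure_rate_le_if_le:
  assumes s: "s \<ge> 2" and "0 \<le> \<beta>" "\<beta> \<le> \<Phi>" "0 \<le> \<gamma>" "\<gamma> \<le> \<Phi>"
  shows "pressure_rate s \<beta> \<gamma> \<le> 3 * (\<Phi> powr (conj_exp s - 1) + \<Phi> powr (s - 1))"
proof -
  have "pressure_rate s \<beta> \<gamma> \<le> pressure_rate s \<Phi> \<Phi>"
    unfolding pressure_rate_def using assms conj_exp_gt_1[of s] by (intro add_mono powr_mono2) auto
  also have "\<dots> = 2 * \<Phi> powr (conj_exp s - 1) + \<Phi> powr (s - 1) + \<Phi>"
    by (simp add: pressure_rate_def)
  also have "\<dots> \<le> 2 * \<Phi> powr (conj_exp s - 1) + 2 * \<Phi> powr (s - 1)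
      + (\<Phi> powr (conj_exp s - 1) + \<Phi> powr (s - 1))"
    using assms by (intro add_mono le_powr_conj_exp_add_powr) auto
  also have "\<dots> = 3 * (\<Phi> powr (conj_exp s - 1) + \<Phi> powr (s - 1))" by simp
  finally show ?thesis .
qed

lemma mult_le_mult_powr:
  assumes s: "s \<ge> 2" and t: "t \<ge> 0" "t powr (conj_exp s - 1) \<le> M" and N: "M \<le> N"
  shows "t * N \<le> M * N powr (s - 1)"
proof -
  have M: "M \<ge> 0" using t(2) powr_ge_zero[of t "conj_exp s - 1"] by linarith
  have "t = (t powr (conj_exp s - 1)) powr (s - 1)"
    using s t by (simp add: powr_conj_exp_powr)
  also have "\<dots> \<le> M powr (s - 1)"
    using s t(2) by (intro powr_mono2) auto
  also have "\<dots> = M * M powr (s - 2)"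
    using M powr_eq_mult_powr_diff_1[of M "s - 1"] by simp
  also have "\<dots> \<le> M * N powr (s - 2)"
    using s M N by (intro mult_left_mono powr_mono2) auto
  finally have "t * N \<le> M * N powr (s - 2) * N"
    using M N by (intro mult_right_mono) auto
  also have "\<dots> = M * N powr (s - 1)"
    using M N powr_eq_mult_powr_diff_1[of N "s - 1"] by simp
  finally show ?thesis .
qed

definition velocity_constant :: "real \<Rightarrow> real \<Rightarrow> real" where
  "velocity_constant K c2 = max 1 ((2 + 3 * K) / c2)"

lemma velocity_estimate:
  assumes s: "s \<ge> 2" and K: "K \<ge> 0" and c2: "c2 > 0" and nonneg: "N \<ge> 0" "D \<ge> 0" "\<beta> \<ge> 0" and D: "D \<le> \<gamma>"
    and P: "P \<le> K * (N + N powr (s - 1) + \<beta>)" and energy: "c2 * N powr s \<le> \<beta> * (N + D) + D * P"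
  shows "N \<le> velocity_constant K c2 * velocity_rate s \<beta> \<gamma>"
proof (cases "N \<le> velocity_rate s \<beta> \<gamma>")
  case True
  then show ?thesis
    using nonneg(1) mult_mono[of 1 "velocity_constant K c2" N "velocity_rate s \<beta> \<gamma>"]
    by (simp add: velocity_constant_def)
next
  case False
  define M where "M = velocity_rate s \<beta> \<gamma>"
  define X where "X = M * N powr (s - 1)"
  have \<gamma>: "\<gamma> \<ge> 0" using nonneg D by simp
  have M: "M \<ge> 0" "M \<le> N" "\<gamma> \<le> M" "\<beta> powr (conj_exp s - 1) \<le> M" "\<gamma> powr (conj_exp s - 1) \<le> M"
    using False \<gamma> by (auto simp: M_def velocity_rate_def)
  have \<beta>N: "\<beta> * N \<le> X" and \<gamma>N: "\<gamma> * N \<le> X"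
    using M \<gamma> nonneg unfolding X_def by (auto intro!: mult_le_mult_powr[OF s])
  have \<beta>\<gamma>: "\<beta> * \<gamma> \<le> X"
    using \<beta>N mult_left_mono[of \<gamma> N \<beta>] M nonneg by simp
  have \<gamma>N_powr: "\<gamma> * N powr (s - 1) \<le> X"
    unfolding X_def using M by (intro mult_right_mono) auto
  have "D * P \<le> \<gamma> * (K * (N + N powr (s - 1) + \<beta>))"
    using P D K nonneg by (intro order_trans[OF mult_left_mono mult_right_mono]) auto
  also have "\<dots> = K * (\<gamma> * N + \<gamma> * N powr (s - 1) + \<beta> * \<gamma>)" by (simp add: algebra_simps)
  also have "\<dots> \<le> K * (X + X + X)"
    using K \<beta>\<gamma> \<gamma>N \<gamma>N_powr by (intro mult_left_mono add_mono) auto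
  finally have "D * P \<le> 3 * K * X" by simp
  moreover have "\<beta> * (N + D) \<le> X + X"
    using \<beta>N \<beta>\<gamma> mult_left_mono[OF D nonneg(3)] by (simp add: distrib_left)
  ultimately have "c2 * N powr s \<le> (2 + 3 * K) * X" using energy by (simp add: algebra_simps)
  then have "N powr s \<le> (2 + 3 * K) / c2 * M * N powr (s - 1)"
    using c2 by (simp add: X_def field_simps)
  then have "N \<le> (2 + 3 * K) / c2 * M"
    using nonneg K c2 M by (intro le_if_powr_le_mult_powr[of N]) auto
  also have "\<dots> \<le> velocity_constant K c2 * M"
    using M by (intro mult_right_mono) (auto simp: velocity_constant_def)
  finally show ?thesis by (simp add: M_def)
qed

lemma pressure_estimate:
  assumes s: "s \<ge> 2" and K: "K \<ge> 0" and k: "k \<ge> 0" and nonneg: "N \<ge> 0" "\<beta> \<ge> 0" "\<gamma> \<ge> 0"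
    and P: "P \<le> K * (N + N powr (s - 1) + \<beta>)" and N: "N \<le> k * velocity_rate s \<beta> \<gamma>"
  shows "P \<le> K * (2 * k + 2 * (4 * k) powr (s - 1) + 1) * pressure_rate s \<beta> \<gamma>"
proof -
  define Q where "Q = pressure_rate s \<beta> \<gamma>"
  have "N \<le> k * (2 * Q)"
    unfolding Q_def
    by (rule order_trans[OF N mult_left_mono[OF velocity_rate_le_pressure_rate[OF s nonneg(2,3)] k]])
  moreover have "N powr (s - 1) \<le> 2 * (4 * k) powr (s - 1) * Q"
  proof -
    have "N powr (s - 1) \<le> (k * velocity_rate s \<beta> \<gamma>) powr (s - 1)"
      using N s nonneg by (intro powr_mono2) auto
    also have "\<dots> = k powr (s - 1) * velocity_rate s \<beta> \<gamma> powr (s - 1)"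
      using k nonneg by (simp add: powr_mult velocity_rate_nonneg)
    also have "\<dots> \<le> k powr (s - 1) * (2 * 4 powr (s - 1) * Q)"
      unfolding Q_def by (intro mult_left_mono velocity_rate_powr_le s nonneg) simp
    finally show ?thesis using k by (simp add: powr_mult mult_ac)
  qed
  moreover have "\<beta> \<le> Q" using nonneg by (simp add: Q_def pressure_rate_def)
  ultimately have "P \<le> K * (k * (2 * Q) + 2 * (4 * k) powr (s - 1) * Q + Q)"
    by (intro order_trans[OF P mult_left_mono[OF _ K]] add_mono)
  then show ?thesis by (simp add: Q_def algebra_simps)
qed

definition coupled_constant :: "real \<Rightarrow> real \<Rightarrow> real \<Rightarrow> real" where
  "coupled_constant s K c2 = max (velocity_constant K c2)
    (K * (2 * velocity_constant K c2 + 2 * (4 * velocity_constant K c2) powr (s - 1) + 1))"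

lemma coupled_constant_ge_1: "coupled_constant s K c2 \<ge> 1"
  by (simp add: coupled_constant_def velocity_constant_def)

lemma
  assumes s: "s \<ge> 2" and K: "K \<ge> 0" and c2: "c2 > 0" and nonneg: "N \<ge> 0" "D \<ge> 0" "\<beta> \<ge> 0" and D: "D \<le> \<gamma>"
    and P: "P \<le> K * (N + N powr (s - 1) + \<beta>)" and energy: "c2 * N powr s \<le> \<beta> * (N + D) + D * P"
  shows coupled_velocity_estimate: "N \<le> coupled_constant s K c2 * velocity_rate s \<beta> \<gamma>"
    and coupled_pressure_estimate: "P \<le> coupled_constant s K c2 * pressure_rate s \<beta> \<gamma>"
proof -
  let ?k = "velocity_constant K c2"
  have \<gamma>: "\<gamma> \<ge> 0" using nonneg D by simp
  have N: "N \<le> ?k * velocity_rate s \<beta> \<gamma>"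
    by (rule velocity_estimate[OF s K c2 nonneg D P energy])
  also have "\<dots> \<le> coupled_constant s K c2 * velocity_rate s \<beta> \<gamma>"
    using \<gamma> by (intro mult_right_mono velocity_rate_nonneg) (simp_all add: coupled_constant_def)
  finally show "N \<le> coupled_constant s K c2 * velocity_rate s \<beta> \<gamma>" .
  have "P \<le> K * (2 * ?k + 2 * (4 * ?k) powr (s - 1) + 1) * pressure_rate s \<beta> \<gamma>"
    using N by (intro pressure_estimate[OF s K _ nonneg(1,3) \<gamma> P]) (simp_all add: velocity_constant_def)
  also have "\<dots> \<le> coupled_constant s K c2 * pressure_rate s \<beta> \<gamma>"
    using nonneg by (intro mult_right_mono pressure_rate_nonneg) (simp_all add: coupled_constant_def)
  finally show "P \<le> coupled_constant s K c2 * pressure_rate s \<beta> \<gamma>" .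
qed

section \<open>Estimates for solutions of the mixed problem\<close>

locale mixed_solution = Wdual_functional \<Omega> s G
  for \<Omega> :: "'a::euclidean_space set" and s :: real and G :: "('a \<Rightarrow> 'a) \<times> ('a \<Rightarrow> real) \<Rightarrow> real" +
  fixes F :: "'a \<Rightarrow> 'a" and u :: "'a \<Rightarrow> 'a" and p :: "'a \<Rightarrow> real"
  assumes in_Wsp: "(u, p) \<in> Wsp \<Omega> s" and solution: "solves \<Omega> s F (u, p) G"
begin

abbreviation \<beta> :: real where "\<beta> \<equiv> pi1_norm \<Omega> s G"
abbreviation \<gamma> :: real where "\<gamma> \<equiv> pi2_norm \<Omega> s G"
abbreviation \<Phi> :: real where "\<Phi> \<equiv> Wdual_norm \<Omega> s G"

lemma velocity_in_Vsp: "u \<in> Vsp \<Omega> s" and Lp_pressure: "Lp \<Omega> (conj_exp s) p"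
  using in_Wsp by (auto simp: Wsp_def)

lemma beta_nonneg: "0 \<le> \<beta>" and gamma_nonneg: "0 \<le> \<gamma>"
  by (simp_all add: pi1_norm_eq_dual_norm pi2_norm_eq_dual_norm pi1.dual_norm_nonneg pi2.dual_norm_nonneg)

lemma abs_functional_velocity_le:
  assumes v: "v \<in> Vsp \<Omega> s"
  shows "\<bar>G (v, \<lambda>x. 0)\<bar> \<le> \<beta> * (Lnorm \<Omega> s v + Lnorm \<Omega> s (wdiv \<Omega> s v))"
proof -
  have "\<bar>G (v, \<lambda>x. 0)\<bar> \<le> \<beta> * Vnorm \<Omega> s v"
    using pi1.abs_le_dual_norm_mult[OF v] by (simp add: pi1_norm_eq_dual_norm)
  also have "\<dots> \<le> \<beta> * (Lnorm \<Omega> s v + Lnorm \<Omega> s (wdiv \<Omega> s v))"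
    by (intro mult_left_mono Vnorm_le exponent_gt_1 beta_nonneg)
  finally show ?thesis .
qed

lemma momentum_balance:
  assumes "v \<in> Vsp \<Omega> s"
  shows "G (v, \<lambda>x. 0) = form_a \<Omega> F u v - form_b \<Omega> s v p"
proof -
  have "opA \<Omega> s F (u, p) (v, \<lambda>x. 0) = G (v, \<lambda>x. 0)"
    using solution Wsp_velocityI[OF assms] unfolding solves_def by blast
  then show ?thesis by (simp add: opA_def form_b_def)
qed

lemma mass_balance:
  assumes "Lp \<Omega> (conj_exp s) q"
  shows "G (\<lambda>x. 0, q) = form_b \<Omega> s u q"
proof -
  \<comment> \<open>\<open>wdiv 0\<close> is only some almost everywhere vanishing function, so that \<open>b(0, p) = 0\<close> needs an argument.\<close>
  have "form_b \<Omega> s (\<lambda>x. 0) p = 0"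
    using momentum_balance[OF Vsp_zero] Wdual_zero[OF functional] by (simp add: form_a_def)
  moreover have "opA \<Omega> s F (u, p) (\<lambda>x. 0, q) = G (\<lambda>x. 0, q)"
    using solution Wsp_pressureI[OF assms] unfolding solves_def by blast
  ultimately show ?thesis by (simp add: opA_def form_a_def)
qed

lemma Lnorm_wdiv_velocity_le: "Lnorm \<Omega> s (wdiv \<Omega> s u) \<le> \<gamma>"
proof (rule Lnorm_le_if_dual_bound[OF exponent_gt_1 Lp_wdiv[OF velocity_in_Vsp] gamma_nonneg])
  fix q :: "'a \<Rightarrow> real" assume q: "Lp \<Omega> (conj_exp s) q"
  have "(\<integral>x. wdiv \<Omega> s u x * q x \<partial>lebesgue_on \<Omega>) = G (\<lambda>x. 0, q)"
    using mass_balance[OF q] by (simp add: form_b_def)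
  also have "\<dots> \<le> \<gamma> * Lnorm \<Omega> (conj_exp s) q"
    using pi2.abs_le_dual_norm_mult[of q] q by (simp add: pi2_norm_eq_dual_norm)
  finally show "(\<integral>x. wdiv \<Omega> s u x * q x \<partial>lebesgue_on \<Omega>) \<le> \<gamma> * Lnorm \<Omega> (conj_exp s) q" .
qed

lemma Lnorm_pressure_le:
  assumes A: "A \<ge> 0" and form_a: "\<And>v. Lp \<Omega> s v \<Longrightarrow> \<bar>form_a \<Omega> F u v\<bar> \<le> A * Lnorm \<Omega> s v"
  shows "Lnorm \<Omega> (conj_exp s) p \<le> A * (diameter \<Omega> + 1) + \<beta> * (diameter \<Omega> + 2)"
proof (rule Lnorm_le_if_dual_bound[OF conj_exp_gt_1[OF exponent_gt_1] Lp_pressure])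
  let ?d = "diameter \<Omega>"
  have d: "?d \<ge> 0" by (rule diameter_ge_0[OF bounded_domain])
  show "0 \<le> A * (?d + 1) + \<beta> * (?d + 2)" using A d beta_nonneg by simp
  fix w :: "'a \<Rightarrow> real" assume "Lp \<Omega> (conj_exp (conj_exp s)) w"
  then have w: "Lp \<Omega> s w" by (simp add: conj_exp_conj_exp exponent_gt_1)
  obtain v where v: "Lp \<Omega> s v" "weak_div \<Omega> v w" and v_le: "Lnorm \<Omega> s v \<le> (?d + 1) * Lnorm \<Omega> s w"
    using weak_div_right_inverse[OF open_domain bounded_domain exponent_gt_1 w] by blast
  have v_Vsp: "v \<in> Vsp \<Omega> s" by (rule VspI[OF v(1) w v(2)])
  have wdiv_meas: "wdiv \<Omega> s v \<in> borel_measurable (lebesgue_on \<Omega>)"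
    using Lp_wdiv[OF v_Vsp] by (simp add: Lp_def)
  have "(\<integral>x. p x * w x \<partial>lebesgue_on \<Omega>) = form_b \<Omega> s v p"
    unfolding form_b_def using Lp_pressure w wdiv_meas wdiv_AE_eq[OF v(1) w v(2)]
    by (intro integral_cong_AE) (auto simp: Lp_def)
  also have "\<dots> = form_a \<Omega> F u v - G (v, \<lambda>x. 0)" using momentum_balance[OF v_Vsp] by simp
  also have "\<dots> \<le> A * Lnorm \<Omega> s v + \<beta> * (Lnorm \<Omega> s v + Lnorm \<Omega> s w)"
    using form_a[OF v(1)] abs_functional_velocity_le[OF v_Vsp] Lnorm_wdiv_eq[OF v(1) w v(2)] by simp
  also have "\<dots> \<le> A * ((?d + 1) * Lnorm \<Omega> s w) + \<beta> * ((?d + 1) * Lnorm \<Omega> s w + Lnorm \<Omega> s w)"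
    using v_le A beta_nonneg by (intro add_mono mult_left_mono) auto
  also have "\<dots> = (A * (?d + 1) + \<beta> * (?d + 2)) * Lnorm \<Omega> s w" by (simp add: algebra_simps)
  finally show "(\<integral>x. p x * w x \<partial>lebesgue_on \<Omega>)
      \<le> (A * (?d + 1) + \<beta> * (?d + 2)) * Lnorm \<Omega> (conj_exp (conj_exp s)) w"
    by (simp add: conj_exp_conj_exp exponent_gt_1)
qed

lemma energy_estimate:
  "form_a \<Omega> F u u \<le> \<beta> * (Lnorm \<Omega> s u + Lnorm \<Omega> s (wdiv \<Omega> s u))
    + Lnorm \<Omega> s (wdiv \<Omega> s u) * Lnorm \<Omega> (conj_exp s) p"
proof -
  have "form_b \<Omega> s u p \<le> (\<integral>x. \<bar>wdiv \<Omega> s u x * p x\<bar> \<partial>lebesgue_on \<Omega>)"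
    unfolding form_b_def by (rule order_trans[OF abs_ge_self integral_abs_bound])
  also have "\<dots> \<le> Lnorm \<Omega> s (wdiv \<Omega> s u) * Lnorm \<Omega> (conj_exp s) p"
    using Lp_Hoelder[OF exponent_gt_1 conj_exp_gt_1 inverse_add_inverse_conj_exp Lp_wdiv Lp_pressure]
      exponent_gt_1 velocity_in_Vsp by (simp add: abs_mult)
  finally show ?thesis
    using abs_functional_velocity_le[OF velocity_in_Vsp] momentum_balance[OF velocity_in_Vsp] by simp
qed

end

section \<open>Coercive fluxes of power growth\<close>

lemma continuous_if_Lipschitz_growth:
  fixes F :: "'a::euclidean_space \<Rightarrow> 'a"
  assumes "s > 2"
    and F: "\<And>x y. norm (F x - F y) \<le> c * (1 + norm x powr (s - 2) + norm y powr (s - 2)) * norm (x - y)"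
  shows "continuous_on UNIV F"
proof -
  have "isCont F y" for y
  proof -
    let ?bound = "\<lambda>x. c * (1 + norm x powr (s - 2) + norm y powr (s - 2)) * norm (x - y)"
    have "((\<lambda>x. norm x powr (s - 2)) \<longlongrightarrow> norm y powr (s - 2)) (at y)"
      using assms(1) by (intro tendsto_powr' tendsto_norm tendsto_ident_at tendsto_const) auto
    then have "(?bound \<longlongrightarrow> ?bound y) (at y)"
      by (intro tendsto_mult tendsto_add tendsto_diff tendsto_norm tendsto_ident_at tendsto_const)
    then have "((\<lambda>x. F x - F y) \<longlongrightarrow> 0) (at y)"
      by (intro Lim_null_comparison[OF always_eventually[OF allI[OF F]]]) simp
    then have "(F \<longlongrightarrow> F y) (at y)" by (rule Lim_null[THEN iffD2])
    then show ?thesis by (simp add: isCont_def)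
  qed
  then show ?thesis by (simp add: continuous_at_imp_continuous_on)
qed

lemma norm_le_if_Lipschitz_growth:
  fixes F :: "'a::euclidean_space \<Rightarrow> 'a"
  assumes "F 0 = 0"
    and F: "\<And>x y. norm (F x - F y) \<le> c * (1 + norm x powr (s - 2) + norm y powr (s - 2)) * norm (x - y)"
  shows "norm (F x) \<le> c * (norm x + norm x powr (s - 1))"
proof -
  have "norm (F x) \<le> c * (1 + norm x powr (s - 2)) * norm x"
    using F[of x 0] assms(1) by simp
  also have "\<dots> = c * (norm x + norm x powr (s - 1))"
    using powr_eq_mult_powr_diff_1[of "norm x" "s - 1"] by (simp add: algebra_simps)
  finally show ?thesis .
qed

locale coercive_mixed_problem = bounded_open_domain \<Omega> s for \<Omega> :: "'a::euclidean_space set" and s :: real +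
  fixes F :: "'a \<Rightarrow> 'a" and c1 c2 :: real
  assumes exponent_gt_2: "s > 2" and c1_nonneg: "c1 \<ge> 0" and c2_pos: "c2 > 0"
    and flux_measurable: "F \<in> borel_measurable borel"
    and flux_growth: "norm (F x) \<le> c1 * (norm x + norm x powr (s - 1))"
    and flux_coercive: "F x \<bullet> x \<ge> c2 * norm x powr s"
begin

definition embedding_constant :: real where
  "embedding_constant = measure lebesgue \<Omega> powr (1 / conj_exp s - 1 / s)"

lemma
  assumes u: "Lp \<Omega> s u"
  shows Lp_conj_exp_if_Lp: "Lp \<Omega> (conj_exp s) u"
    and Lnorm_conj_exp_le: "Lnorm \<Omega> (conj_exp s) u \<le> embedding_constant * Lnorm \<Omega> s u"
proof -
  have "1 \<le> conj_exp s" "conj_exp s < s"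
    using exponent_gt_2 by (auto simp: conj_exp_def field_simps)
  then show "Lp \<Omega> (conj_exp s) u" "Lnorm \<Omega> (conj_exp s) u \<le> embedding_constant * Lnorm \<Omega> s u"
    using Lp_antimono[OF lmeasurable_domain _ _ u] Lnorm_le_measure_mult_Lnorm[OF lmeasurable_domain _ _ u]
    by (auto simp: embedding_constant_def)
qed

lemma abs_flux_inner_le: "\<bar>F x \<bullet> y\<bar> \<le> c1 * (norm x * norm y + norm x powr (s - 1) * norm y)"
  using order_trans[OF Cauchy_Schwarz_ineq2 mult_right_mono[OF flux_growth norm_ge_zero]]
  by (simp add: algebra_simps)

lemma
  assumes u: "Lp \<Omega> s u" and v: "Lp \<Omega> s v"
  shows integrable_form_a: "integrable (lebesgue_on \<Omega>) (\<lambda>x. F (u x) \<bullet> v x)"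
    and abs_form_a_le: "\<bar>form_a \<Omega> F u v\<bar>
      \<le> c1 * (embedding_constant * Lnorm \<Omega> s u + Lnorm \<Omega> s u powr (s - 1)) * Lnorm \<Omega> s v"
proof -
  define f where "f x = norm (u x) powr (s - 1)" for x
  define h where "h x = c1 * (norm (u x) * norm (v x) + norm (f x) * norm (v x))" for x
  have f_meas: "f \<in> borel_measurable (lebesgue_on \<Omega>)"
    using u by (auto simp: Lp_def f_def[abs_def])
  have f: "Lp \<Omega> (conj_exp s) f" "Lnorm \<Omega> (conj_exp s) f = Lnorm \<Omega> s u powr (s - 1)"
    using Lp_conj_exp_if_norm_eq_powr[OF exponent_gt_1 u f_meas]
      Lnorm_conj_exp_if_norm_eq_powr[OF exponent_gt_1 u f_meas] by (auto simp: f_def)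
  have exps: "conj_exp s > 1" "s > 1" "1 / conj_exp s + 1 / s = 1"
    using conj_exp_gt_1 inverse_add_inverse_conj_exp exponent_gt_1 by (auto simp: add.commute)
  note Hoelder_int = Lp_Hoelder_integrable[OF exps Lp_conj_exp_if_Lp[OF u] v]
    Lp_Hoelder_integrable[OF exps f(1) v]
  have h_int: "integrable (lebesgue_on \<Omega>) h"
    unfolding h_def[abs_def] using Hoelder_int by simp
  have h_bound: "\<bar>F (u x) \<bullet> v x\<bar> \<le> h x" for x
    using abs_flux_inner_le[of "u x" "v x"] by (simp add: h_def f_def)
  have meas: "(\<lambda>x. F (u x) \<bullet> v x) \<in> borel_measurable (lebesgue_on \<Omega>)"
    using u v by (auto simp: Lp_def intro!: borel_measurable_inner measurable_compose[OF _ flux_measurable])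
  show int: "integrable (lebesgue_on \<Omega>) (\<lambda>x. F (u x) \<bullet> v x)"
    by (rule Bochner_Integration.integrable_bound[OF h_int meas])
       (use h_bound in \<open>simp add: order_trans[OF _ abs_ge_self]\<close>)
  have "\<bar>form_a \<Omega> F u v\<bar> \<le> (\<integral>x. h x \<partial>lebesgue_on \<Omega>)"
    unfolding form_a_def using int h_int h_bound by (intro integral_abs_bound_integral)
  also have "\<dots> = c1 * ((\<integral>x. norm (u x) * norm (v x) \<partial>lebesgue_on \<Omega>)
      + (\<integral>x. norm (f x) * norm (v x) \<partial>lebesgue_on \<Omega>))"
    unfolding h_def using Hoelder_int by simp
  also have "\<dots> \<le> c1 * (embedding_constant * Lnorm \<Omega> s u * Lnorm \<Omega> s v
      + Lnorm \<Omega> s u powr (s - 1) * Lnorm \<Omega> s v)"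
    using Lp_Hoelder[OF exps f(1) v] mult_right_mono[OF Lnorm_conj_exp_le[OF u] Lnorm_nonneg[of \<Omega> s v]]
      Lp_Hoelder[OF exps Lp_conj_exp_if_Lp[OF u] v]
    by (intro mult_left_mono add_mono c1_nonneg) (simp_all add: f(2))
  finally show "\<bar>form_a \<Omega> F u v\<bar>
      \<le> c1 * (embedding_constant * Lnorm \<Omega> s u + Lnorm \<Omega> s u powr (s - 1)) * Lnorm \<Omega> s v"
    by (simp add: algebra_simps)
qed

lemma form_a_coercive:
  assumes u: "Lp \<Omega> s u"
  shows "c2 * Lnorm \<Omega> s u powr s \<le> form_a \<Omega> F u u"
proof -
  have "c2 * Lnorm \<Omega> s u powr s = (\<integral>x. c2 * norm (u x) powr s \<partial>lebesgue_on \<Omega>)"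
    using exponent_gt_1 by (simp add: Lnorm_powr)
  also have "\<dots> \<le> form_a \<Omega> F u u"
    unfolding form_a_def using u integrable_form_a[OF u u] flux_coercive
    by (intro integral_mono) (auto simp: Lp_def)
  finally show ?thesis .
qed

definition pressure_constant :: real where
  "pressure_constant = (c1 * (embedding_constant + 1) + 1) * (diameter \<Omega> + 2)"

lemma pressure_constant_nonneg: "0 \<le> pressure_constant"
  using c1_nonneg diameter_ge_0[OF bounded_domain]
  by (simp add: pressure_constant_def embedding_constant_def)

definition estimate_constant :: real where
  "estimate_constant = coupled_constant s pressure_constant c2"

lemma estimate_constant_ge_1: "estimate_constant \<ge> 1"
  by (simp add: estimate_constant_def coupled_constant_ge_1)

end

locale coercive_mixed_solution = coercive_mixed_problem \<Omega> s F c1 c2 + mixed_solution \<Omega> s G F u p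
  for \<Omega> :: "'a::euclidean_space set" and s F c1 c2 G u p
begin

lemma Lnorm_pressure_le_velocity:
  "Lnorm \<Omega> (conj_exp s) p \<le> pressure_constant * (Lnorm \<Omega> s u + Lnorm \<Omega> s u powr (s - 1) + \<beta>)"
proof -
  define N where "N = Lnorm \<Omega> s u"
  define A where "A = c1 * (embedding_constant + 1)"
  have m: "embedding_constant \<ge> 0" by (simp add: embedding_constant_def)
  have d: "diameter \<Omega> \<ge> 0" by (rule diameter_ge_0[OF bounded_domain])
  have N: "N \<ge> 0" by (simp add: N_def Lnorm_nonneg)
  have A: "A \<ge> 0" using m c1_nonneg by (simp add: A_def)
  have "Lnorm \<Omega> (conj_exp s) p
      \<le> c1 * (embedding_constant * N + N powr (s - 1)) * (diameter \<Omega> + 1) + \<beta> * (diameter \<Omega> + 2)"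
    unfolding N_def using m c1_nonneg
    by (intro Lnorm_pressure_le abs_form_a_le Vsp_imp_Lp[OF velocity_in_Vsp]) (simp_all add: Lnorm_nonneg)
  also have "\<dots> \<le> A * (N + N powr (s - 1)) * (diameter \<Omega> + 2) + \<beta> * (diameter \<Omega> + 2)"
  proof -
    have "c1 * (embedding_constant * N + N powr (s - 1))
        \<le> c1 * ((embedding_constant + 1) * (N + N powr (s - 1)))"
      using m N c1_nonneg by (intro mult_left_mono) (simp_all add: algebra_simps)
    then have "c1 * (embedding_constant * N + N powr (s - 1)) \<le> A * (N + N powr (s - 1))"
      by (simp add: A_def mult.assoc)
    then show ?thesis using A N d by (intro add_right_mono mult_mono[of _ "A * _"]) auto
  qed
  also have "\<dots> = (A * (N + N powr (s - 1)) + \<beta>) * (diameter \<Omega> + 2)" by (simp add: algebra_simps)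
  also have "\<dots> \<le> (A + 1) * (N + N powr (s - 1) + \<beta>) * (diameter \<Omega> + 2)"
    using mult_nonneg_nonneg[OF A beta_nonneg] N d by (intro mult_right_mono) (simp_all add: algebra_simps)
  finally show ?thesis by (simp add: pressure_constant_def A_def N_def mult_ac)
qed

lemma velocity_energy_le:
  "c2 * Lnorm \<Omega> s u powr s \<le> \<beta> * (Lnorm \<Omega> s u + Lnorm \<Omega> s (wdiv \<Omega> s u))
    + Lnorm \<Omega> s (wdiv \<Omega> s u) * Lnorm \<Omega> (conj_exp s) p"
  by (rule order_trans[OF form_a_coercive[OF Vsp_imp_Lp[OF velocity_in_Vsp]] energy_estimate])

lemma Lnorm_velocity_estimate: "Lnorm \<Omega> s u \<le> estimate_constant * velocity_rate s \<beta> \<gamma>"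
  and Lnorm_pressure_estimate: "Lnorm \<Omega> (conj_exp s) p \<le> estimate_constant * pressure_rate s \<beta> \<gamma>"
proof -
  have s: "s \<ge> 2" using exponent_gt_2 by simp
  note inequalities = s pressure_constant_nonneg c2_pos Lnorm_nonneg Lnorm_nonneg beta_nonneg
    Lnorm_wdiv_velocity_le Lnorm_pressure_le_velocity velocity_energy_le
  show "Lnorm \<Omega> s u \<le> estimate_constant * velocity_rate s \<beta> \<gamma>"
    unfolding estimate_constant_def by (rule coupled_velocity_estimate[OF inequalities])
  show "Lnorm \<Omega> (conj_exp s) p \<le> estimate_constant * pressure_rate s \<beta> \<gamma>"
    unfolding estimate_constant_def by (rule coupled_pressure_estimate[OF inequalities])
qed

lemma Lnorm_wdiv_velocity_estimate: "Lnorm \<Omega> s (wdiv \<Omega> s u) \<le> estimate_constant * \<gamma>"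
  using Lnorm_wdiv_velocity_le mult_right_mono[OF estimate_constant_ge_1 gamma_nonneg] by simp

lemma Wnorm_estimate: "Wnorm \<Omega> s (u, p) \<le> 4 * estimate_constant * pressure_rate s \<beta> \<gamma>"
proof -
  let ?c = estimate_constant and ?Q = "pressure_rate s \<beta> \<gamma>"
  have c: "?c \<ge> 0" using estimate_constant_ge_1 by simp
  have s: "s \<ge> 2" using exponent_gt_2 by simp
  note rates = velocity_rate_le_pressure_rate[OF s beta_nonneg gamma_nonneg]
    le_pressure_rate[OF s beta_nonneg gamma_nonneg]
  have "Wnorm \<Omega> s (u, p) \<le> Lnorm \<Omega> s u + Lnorm \<Omega> s (wdiv \<Omega> s u) + Lnorm \<Omega> (conj_exp s) p"
    using Vnorm_le[OF exponent_gt_1] by (simp add: Wnorm_def)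
  also have "\<dots> \<le> ?c * velocity_rate s \<beta> \<gamma> + ?c * \<gamma> + ?c * ?Q"
    by (intro add_mono Lnorm_velocity_estimate Lnorm_wdiv_velocity_estimate Lnorm_pressure_estimate)
  also have "\<dots> \<le> ?c * (2 * ?Q) + ?c * ?Q + ?c * ?Q"
    by (intro add_mono mult_left_mono rates c order_refl)
  finally show ?thesis by simp
qed

lemma Wnorm_estimate_Wdual_norm:
  "Wnorm \<Omega> s (u, p) \<le> 12 * estimate_constant * (\<Phi> powr (conj_exp s - 1) + \<Phi> powr (s - 1))"
proof -
  have "pressure_rate s \<beta> \<gamma> \<le> 3 * (\<Phi> powr (conj_exp s - 1) + \<Phi> powr (s - 1))"
    using exponent_gt_2 beta_nonneg gamma_nonneg pi1_norm_le_Wdual_norm pi2_norm_le_Wdual_norm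
    by (intro pressure_rate_le_if_le) simp_all
  then have "4 * estimate_constant * pressure_rate s \<beta> \<gamma>
      \<le> 4 * estimate_constant * (3 * (\<Phi> powr (conj_exp s - 1) + \<Phi> powr (s - 1)))"
    using estimate_constant_ge_1 by (intro mult_left_mono) simp_all
  with Wnorm_estimate show ?thesis by (simp add: algebra_simps)
qed

end

theorem mainTheorem17:
  fixes \<Omega> :: "'a::euclidean_space set" and F :: "'a \<Rightarrow> 'a" and s c1 c2 :: real
  assumes "DIM('a) \<ge> 2"
    and "open \<Omega>" and "bounded \<Omega>" and "C1_boundary \<Omega>"
    and "s > 2" and "c1 > 0" and "c2 > 0"
    and "F 0 = 0"
    and "\<And>x y. norm (F x - F y) \<le> c1 * (1 + norm x powr (s - 2) + norm y powr (s - 2)) * norm (x - y)"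
    and "\<And>x y. (F x - F y) \<bullet> (x - y) \<ge> c2 * norm (x - y) powr s"
  shows "\<exists>c7 c8 c9. c7 > 0 \<and> c8 > 0 \<and> c9 > 0 \<and>
    (\<forall>G u p. G \<in> Wdual \<Omega> s \<longrightarrow> (u, p) \<in> Wsp \<Omega> s \<longrightarrow> solves \<Omega> s F (u, p) G \<longrightarrow>
      (let r = conj_exp s; \<beta> = pi1_norm \<Omega> s G; \<gamma> = pi2_norm \<Omega> s G; \<Phi> = Wdual_norm \<Omega> s G in
        Lnorm \<Omega> s u \<le> c7 * (\<beta> powr (r - 1) + \<gamma> powr (r - 1) + \<gamma>)
        \<and> Lnorm \<Omega> s (wdiv \<Omega> s u) \<le> c7 * \<gamma>
        \<and> Lnorm \<Omega> r p \<le> c7 * (\<gamma> powr (r - 1) + \<gamma> powr (s - 1) + \<beta> powr (r - 1) + \<beta>)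
        \<and> Wnorm \<Omega> s (u, p) \<le> c8 * (\<gamma> powr (r - 1) + \<gamma> powr (s - 1) + \<beta> powr (r - 1) + \<beta>)
        \<and> Wnorm \<Omega> s (u, p) \<le> c9 * (\<Phi> powr (r - 1) + \<Phi> powr (s - 1))))"
proof -
  interpret coercive_mixed_problem \<Omega> s F c1 c2
  proof
    show "F \<in> borel_measurable borel"
      by (rule borel_measurable_continuous_onI[OF continuous_if_Lipschitz_growth[OF assms(5,9)]])
    show "norm (F x) \<le> c1 * (norm x + norm x powr (s - 1))" "c2 * norm x powr s \<le> F x \<bullet> x" for x
      using norm_le_if_Lipschitz_growth[OF assms(8,9)] assms(8) assms(10)[of x 0] by auto
  qed (use assms in auto)
  let ?c = estimate_constant
  show ?thesis (is "\<exists>c7 c8 c9. _ \<and> _ \<and> _ \<and> (\<forall>G u p. _ \<longrightarrow> _ \<longrightarrow> _ \<longrightarrow> ?estimates c7 c8 c9 G u p)")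
  proof (rule exI[of _ ?c], rule exI[of _ "4 * ?c"], rule exI[of _ "12 * ?c"], intro conjI allI impI)
    fix G u p assume "G \<in> Wdual \<Omega> s" "(u, p) \<in> Wsp \<Omega> s" "solves \<Omega> s F (u, p) G"
    then interpret coercive_mixed_solution \<Omega> s F c1 c2 G u p by unfold_locales
    show "?estimates ?c (4 * ?c) (12 * ?c) G u p"
      using Lnorm_velocity_estimate Lnorm_wdiv_velocity_estimate Lnorm_pressure_estimate
        Wnorm_estimate Wnorm_estimate_Wdual_norm
      by (simp add: Let_def velocity_rate_def pressure_rate_def)
  qed (use estimate_constant_ge_1 in auto)
qed

end
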